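(* Let $p\in[0,1)$, let $m$ and $k$ be positive integers, and let $n_1<n_2<\cdots<n_m$ be positive integers. For $n\ge 1$ let $S_n$ be the rank over the field $\mathbb{F}_2$ of the random $k\times n$ generator matrix $G(1:n)$ of the ST-RLFC scheme over BEC$(p)$ (defined in the context). Then there exists an $(l,n_1^m,2^k,\epsilon)$ VLSF code for the BEC$(p)$ with $$l\;\le\; n_m-\sum_{i=1}^{m-1}(n_{i+1}-n_i)\,\mathbb{P}[S_{n_i}=k],\qquad \epsilon\;\le\;1-\mathbb{P}[S_{n_m}=k].$$ That is, there is a VLSF code with message size $2^k$ and decoding times $n_1,\dots,n_m$ whose average decoding time $\mathbb{E}[\tau]$ is at most the first right-hand side and whose average error probability is at most the second right-hand side. Specifically, $$\mathbb{P}[S_n=k]=\begin{cases}0, & n<k,\\ 1-\bm{\alpha}^\top T^{\,n-k}\bm{1}, & n\ge k,\end{cases}$$ where $\bm{1}\in\mathbb{R}^{k\times 1}$ is the all-ones vector, $\bm{\alpha}\in\mathbb{R}^{k\times 1}$ has entries $$\bm{\alpha}^\top=\Big[\tbinom{k}{0}(1-p)^0p^{k},\ \tbinom{k}{1}(1-p)^1p^{k-1},\ \dots,\ \tbinom{k}{k-1}(1-p)^{k-1}p\Big]$$ (with the convention $0^0=1$), and $T\in\mathbb{R}^{k\times k}$ (with $T^0=I$) has entries, for $1\le i,j\le k$, $$T_{i,i}=p+\frac{(1-p)(2^{i-1}-1)}{2^k-1},\qquad T_{i,i+1}=\frac{(1-p)(2^k-2^{i-1})}{2^k-1}\ \ (i\le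 k-1),\qquad T_{i,j}=0\ \text{ for } j\ne i,\ j\ne i+1.$$
   Context: Notation: $[M]=\{1,\dots,M\}$, and $n_1^m=(n_1,\dots,n_m)$. Channel: the BEC$(p)$ is the memoryless channel with input alphabet $\mathcal{X}=\{0,1\}$ and output alphabet $\mathcal{Y}=\{0,?,1\}$. At each time $n=1,2,\dots$, independently of everything else, the output $Y_n$ equals the erasure symbol $?$ with probability $p$, and equals the input $X_n$ with probability $1-p$. Write $Y^n=(Y_1,\dots,Y_n)$. An $(l,n_1^m,M,\epsilon)$ variable-length stop-feedback (VLSF) code (finitely many decoding times $n_1<\cdots<n_m$) consists of: 1) A finite alphabet $\mathcal{U}$ and a probability distribution on $\mathcal{U}$ defining a random variable $U$ (common randomness), independent of the message and of the channel erasures, revealed to both transmitter and receiver before transmission. 2) A sequence of encoders $f_n:\mathcal{U}\times[M]\to\mathcal{X}$, $n=1,\dots,n_m$, defining the channel inputs $X_n=f_n(U,W)$, where $W$ is uniformly distributed on $[M]$. 3) A random stopping time $\tau\in\{n_1,\dots,n_m\}$ of the filtration generated by $\{U,Y^{n_i}\}_{i=1}^m$, satisfying $\mathbb{E}[\tau]\le l$. 4) Decoding functions $g_{n_i}:\mathcal{U}\times\mathcal{Y}^{n_i}\to[M]$, $i\in[m]$. The final decision $\hat W=g_\tau(U,Y^\tau)$ must satisfy $\mathbb{P}[\hat W\ne W]\le\epsilon$. ST-RLFC scheme (systematic transmission followed by random linear fountain coding) and its generator matrix: for $1\le n\le k$ let $\bm{g}_n=\bm{e}_n\in\{0,1\}^k$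 be the $n$th standard basis vector. For $n>k$ let $\bm{g}_n$ be drawn uniformly at random from the set $\{0,1\}^k\setminus\{\bm{0}\}$, independently over $n$ and independently of the message and the channel. A message $\bm{b}\in\{0,1\}^k$ is encoded at time $n$ as $X_n=\bigoplus_{i=1}^k g_{n,i}b_i$ (sum modulo $2$), so that $X_n=b_n$ for $n\le k$. The vectors $\bm{g}_n$ are known to both encoder and decoder. The generator matrix $G(1:n)$ associated with the received symbols $Y^n$ is the $k\times n$ matrix over $\mathbb{F}_2$ whose $j$th column is $\bm{0}$ if $Y_j=?$ and $\bm{g}_j$ otherwise. *)

theory Defs
  imports
    "HOL-Probability.Probability"
    "HOL-Library.Z2"
    "Jordan_Normal_Form.DL_Rank"
begin

section \<open>The binary erasure channel\<close>

text \<open>Channel inputs are elements of the two-element field \<^typ>\<open>bit\<close>; the output \<open>None\<close> is the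
  erasure symbol. Time starts at 1. The channel noise is the i.i.d. erasure pattern \<open>e\<close>, where
  \<open>e n\<close> means that the symbol sent at time \<open>n\<close> is erased.\<close>

definition bec_erasures :: "real \<Rightarrow> (nat \<Rightarrow> bool) measure" where
  "bec_erasures p = (\<Pi>\<^sub>M n\<in>{1..}. measure_pmf (bernoulli_pmf p))"

definition bec_output :: "(nat \<Rightarrow> bit) \<Rightarrow> (nat \<Rightarrow> bool) \<Rightarrow> nat \<Rightarrow> bit option" where
  "bec_output x e n = (if e n then None else Some (x n))"


section \<open>Variable-length stop-feedback codes\<close>

text \<open>\<open>rand c\<close> is the finite alphabet of the common randomness together with the distribution on
  it (see \<open>is_vlsf_code\<close>). A sample point \<open>(u, w, e)\<close> consists of the common randomness, the
  message and the erasure pattern. The stopping time is a random variable, i.e. a function of the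
  whole sample point; that it only uses what the receiver has seen is imposed through the
  filtration below.\<close>

record 'u vlsf_code =
  rand :: "'u measure"
  enc :: "nat \<Rightarrow> 'u \<Rightarrow> nat \<Rightarrow> bit"
  stop :: "'u \<times> nat \<times> (nat \<Rightarrow> bool) \<Rightarrow> nat"
  dec :: "nat \<Rightarrow> 'u \<Rightarrow> bit option list \<Rightarrow> nat"

definition vlsf_space ::
  "real \<Rightarrow> nat \<Rightarrow> 'u vlsf_code \<Rightarrow> ('u \<times> nat \<times> (nat \<Rightarrow> bool)) measure" where
  "vlsf_space p M c = rand c \<Otimes>\<^sub>M (uniform_count_measure {1..M} \<Otimes>\<^sub>M bec_erasures p)"

text \<open>The received word \<open>Y\<^sup>t = (Y\<^sub>1, \<dots>, Y\<^sub>t)\<close>.\<close>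

definition vlsf_received ::
  "'u vlsf_code \<Rightarrow> nat \<Rightarrow> 'u \<times> nat \<times> (nat \<Rightarrow> bool) \<Rightarrow> bit option list" where
  "vlsf_received c t = (\<lambda>(u, w, e). map (bec_output (\<lambda>j. enc c j u w) e) [1..<Suc t])"

text \<open>The \<open>\<sigma>\<close>-algebra at time \<open>t\<close> is generated by \<open>U\<close> and by those \<open>Y\<^bsup>n i\<^esup>\<close>, \<open>1 \<le> i \<le> m\<close>, with
  \<open>n i \<le> t\<close>. (The generating map takes finitely many values, hence taking all sets as measurable
  in its codomain is harmless.)\<close>

definition vlsf_filtration ::
  "real \<Rightarrow> (nat \<Rightarrow> nat) \<Rightarrow> nat \<Rightarrow> nat \<Rightarrow> 'u vlsf_code \<Rightarrow> nat \<Rightarrow> ('u \<times> nat \<times> (nat \<Rightarrow> bool)) measure"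
  where
  "vlsf_filtration p n m M c t =
     vimage_algebra (space (vlsf_space p M c))
       (\<lambda>\<omega>. (fst \<omega>, \<lambda>i\<in>{i\<in>{1..m}. n i \<le> t}. vlsf_received c (n i) \<omega>))
       (count_space UNIV)"

definition vlsf_decision :: "'u vlsf_code \<Rightarrow> 'u \<times> nat \<times> (nat \<Rightarrow> bool) \<Rightarrow> nat" where
  "vlsf_decision c \<omega> = dec c (stop c \<omega>) (fst \<omega>) (vlsf_received c (stop c \<omega>) \<omega>)"

definition is_vlsf_code ::
  "real \<Rightarrow> real \<Rightarrow> (nat \<Rightarrow> nat) \<Rightarrow> nat \<Rightarrow> nat \<Rightarrow> real \<Rightarrow> 'u vlsf_code \<Rightarrow> bool" where
  "is_vlsf_code p l n m M \<epsilon> c \<longleftrightarrow>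
     finite (space (rand c)) \<and> sets (rand c) = Pow (space (rand c)) \<and> prob_space (rand c) \<and>
     (\<forall>\<omega>\<in>space (vlsf_space p M c). stop c \<omega> \<in> n ` {1..m}) \<and>
     stopping_time (vlsf_filtration p n m M c) (stop c) \<and>
     (\<integral>\<omega>. real (stop c \<omega>) \<partial>vlsf_space p M c) \<le> l \<and>
     (\<forall>i\<in>{1..m}. \<forall>u\<in>space (rand c). \<forall>y. length y = n i \<longrightarrow> dec c (n i) u y \<in> {1..M}) \<and>
     \<P>(\<omega> in vlsf_space p M c. vlsf_decision c \<omega> \<noteq> fst (snd \<omega>)) \<le> \<epsilon>"


section \<open>Systematic transmission followed by random linear fountain coding\<close>

definition rlfc_gen :: "nat \<Rightarrow> nat \<Rightarrow> bit vec pmf" where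
  "rlfc_gen k n = (if n \<le> k then return_pmf (unit_vec k (n - 1))
                   else pmf_of_set (carrier_vec k - {0\<^sub>v k}))"

text \<open>A sample point \<open>(b, g, e)\<close> consists of the uniformly distributed message, the sequence of
  generator vectors and the erasure pattern.\<close>

definition rlfc_space :: "real \<Rightarrow> nat \<Rightarrow> (bit vec \<times> (nat \<Rightarrow> bit vec) \<times> (nat \<Rightarrow> bool)) measure" where
  "rlfc_space p k =
     measure_pmf (pmf_of_set (carrier_vec k)) \<Otimes>\<^sub>M
       ((\<Pi>\<^sub>M n\<in>{1..}. measure_pmf (rlfc_gen k n)) \<Otimes>\<^sub>M bec_erasures p)"

definition rlfc_received :: "bit vec \<times> (nat \<Rightarrow> bit vec) \<times> (nat \<Rightarrow> bool) \<Rightarrow> nat \<Rightarrow> bit option" where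
  "rlfc_received = (\<lambda>(b, g, e). bec_output (\<lambda>n. scalar_prod (g n) b) e)"

text \<open>Matrix indices start at 0, so column \<open>j\<close> belongs to time \<open>j + 1\<close>.\<close>

definition rlfc_matrix ::
  "nat \<Rightarrow> nat \<Rightarrow> bit vec \<times> (nat \<Rightarrow> bit vec) \<times> (nat \<Rightarrow> bool) \<Rightarrow> bit mat" where
  "rlfc_matrix k n \<omega> =
     mat k n (\<lambda>(i, j). if rlfc_received \<omega> (Suc j) = None then 0
                       else vec_index (fst (snd \<omega>) (Suc j)) i)"

definition rlfc_rank :: "nat \<Rightarrow> nat \<Rightarrow> bit vec \<times> (nat \<Rightarrow> bit vec) \<times> (nat \<Rightarrow> bool) \<Rightarrow> nat" where
  "rlfc_rank k n \<omega> = vec_space.rank k (rlfc_matrix k n \<omega>)"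

text \<open>In 0-based indexing the entries of \<open>\<alpha>\<close> and the rows and columns of \<open>T\<close> are indexed by the
  ranks \<open>0, \<dots>, k - 1\<close>.\<close>

definition rlfc_alpha :: "real \<Rightarrow> nat \<Rightarrow> real vec" where
  "rlfc_alpha p k = vec k (\<lambda>i. real (k choose i) * (1 - p) ^ i * p ^ (k - i))"

definition rlfc_T :: "real \<Rightarrow> nat \<Rightarrow> real mat" where
  "rlfc_T p k = mat k k (\<lambda>(i, j).
     if j = i then p + (1 - p) * (2 ^ i - 1) / (2 ^ k - 1)
     else if j = i + 1 then (1 - p) * (2 ^ k - 2 ^ i) / (2 ^ k - 1)
     else 0)"

end

theory Submission
  imports Defs
begin

text \<open>Over the two-element field a span has \<open>2 ^ r\<close> elements, where \<open>r\<close> is the rank, so the probability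
  that a new column raises the rank depends on the past only through the rank. In the systematic
  phase this probability is \<open>1 - p\<close> and the rank after \<open>k\<close> steps is binomial, which is \<open>\<alpha>\<close>; afterwards
  the ranks below \<open>k\<close> evolve by the substochastic matrix \<open>T\<close>.

  The code uses the generator vectors up to time \<open>n m\<close> as common randomness and stops at the first
  decoding time at which the received columns have rank \<open>k\<close>. At such a time the message is the only
  one consistent with the received word. The expected stopping time is obtained by telescoping over
  the decoding times that have not yet been passed.\<close>

unbundle no vec_syntax

text \<open>These simplification rules would replace addition and multiplication of bits by bit operations,
  after which the simplifier no longer recognises the vector space over the two-element field.\<close>

declare add_bit_eq_xor [simp del] mult_bit_eq_and [simp del]

section \<open>Ranks over the two-element field\<close>


text \<open>A combination that uses \<open>v\<close> splits into its term at \<open>v\<close> and a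
  combination over \<open>S\<close>; any other one already lies in \<open>span S\<close>.\<close>

lemma (in vec_space) span_insert:
  assumes S: "S \<subseteq> carrier_vec n" and v: "v \<in> carrier_vec n"
  shows "span (insert v S) = {c \<cdot>\<^sub>v v + w | c w. w \<in> span S}"
proof
  have iS: "insert v S \<subseteq> carrier_vec n" using S v by simp
  show "{c \<cdot>\<^sub>v v + w | c w. w \<in> span S} \<subseteq> span (insert v S)"
  proof clarify
    fix c w assume w: "w \<in> span S"
    have "v \<in> span (insert v S)" using span_mem[OF iS] by simp
    hence "c \<cdot>\<^sub>v v \<in> span (insert v S)" using smult_in_span[OF iS] by simp
    moreover have "w \<in> span (insert v S)" using w span_is_monotone[of S "insert v S"] by auto
    ultimately show "c \<cdot>\<^sub>v v + w \<in> span (insert v S)" using span_add1[OF iS] by simp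
  qed
  show "span (insert v S) \<subseteq> {c \<cdot>\<^sub>v v + w | c w. w \<in> span S}"
  proof
    fix x assume "x \<in> span (insert v S)"
    then obtain a A where x: "x = lincomb a A" and A: "finite A" "A \<subseteq> insert v S"
      using in_spanE by blast
    show "x \<in> {c \<cdot>\<^sub>v v + w | c w. w \<in> span S}"
    proof (cases "v \<in> A")
      case True
      define B where "B = A - {v}"
      have B: "finite B" "B \<subseteq> S" "v \<notin> B" "A = insert v B" "B \<subseteq> carrier_vec n"
        using A True S by (auto simp: B_def)
      have "x = a v \<cdot>\<^sub>v v + lincomb a B"
        unfolding x B(4) using lincomb_insert2[OF B(1) B(5) _ B(3) v] by simp
      moreover have "lincomb a B \<in> span S" using B by blast
      ultimately show ?thesis by blast
    next
      case False
      hence "x \<in> span S" using x A by blast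
      moreover have "x = 0 \<cdot>\<^sub>v v + x"
        using span_closed[OF _ \<open>x \<in> span S\<close>] S v by simp
      ultimately show ?thesis by blast
    qed
  qed
qed

abbreviation bit_span :: "nat \<Rightarrow> bit vec set \<Rightarrow> bit vec set" where
  "bit_span k \<equiv> LinearCombinations.module.span class_ring (module_vec TYPE(bit) k)"

text \<open>The only scalars are 0 and 1, so a new generator contributes just one translate of the
  old span.\<close>

lemma bit_span_insert:
  assumes "S \<subseteq> carrier_vec k" "v \<in> carrier_vec k"
  shows "bit_span k (insert v S) = bit_span k S \<union> (+) v ` bit_span k S"
proof -
  interpret vec_space "TYPE(bit)" k .
  have "0 \<cdot>\<^sub>v v + w = w" "1 \<cdot>\<^sub>v v + w = v + w" if "w \<in> span S" for w
    using span_closed[OF _ that] assms by auto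
  note scale = this
  show ?thesis
  proof (rule subset_antisym; rule subsetI)
    fix x assume "x \<in> span (insert v S)"
    then obtain c w where x: "x = c \<cdot>\<^sub>v v + w" and w: "w \<in> span S"
      unfolding span_insert[OF assms] by blast
    show "x \<in> span S \<union> (+) v ` span S"
      by (cases c) (use x w scale[OF w] in auto)
  next
    fix x assume "x \<in> span S \<union> (+) v ` span S"
    then consider "x \<in> span S" | w where "w \<in> span S" "x = v + w" by blast
    thus "x \<in> span (insert v S)"
    proof cases
      case 1
      thus ?thesis unfolding span_insert[OF assms]
        by (intro CollectI exI[of _ 0] exI[of _ x]) (simp add: scale)
    next
      case 2
      thus ?thesis unfolding span_insert[OF assms]
        by (intro CollectI exI[of _ 1] exI[of _ w]) (simp add: scale)
    qed
  qed
qed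

lemma finite_carrier_vec_bit [simp]: "finite (carrier_vec k :: bit vec set)"
  and card_carrier_vec_bit [simp]: "card (carrier_vec k :: bit vec set) = 2 ^ k"
proof -
  have bij: "bij_betw list_of_vec (carrier_vec k) {xs :: bit list. set xs \<subseteq> UNIV \<and> length xs = k}"
  proof (rule bij_betw_byWitness[where f' = vec_of_list])
    show "\<forall>v\<in>carrier_vec k. vec_of_list (list_of_vec v) = (v :: bit vec)"
      by (simp add: vec_list)
    show "\<forall>xs\<in>{xs :: bit list. set xs \<subseteq> UNIV \<and> length xs = k}. list_of_vec (vec_of_list xs) = xs"
      by (simp add: list_vec)
    show "list_of_vec ` carrier_vec k \<subseteq> {xs :: bit list. set xs \<subseteq> UNIV \<and> length xs = k}"
      by (rule image_subsetI) simp
    show "vec_of_list ` {xs :: bit list. set xs \<subseteq> UNIV \<and> length xs = k} \<subseteq> carrier_vec k"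
      by (rule image_subsetI, rule carrier_vecI) (unfold dim_vec_of_list mem_Collect_eq, blast)
  qed
  have U: "(UNIV :: bit set) = {0, 1}" using bit_not_zero_iff by auto
  have fU: "finite (UNIV :: bit set)" unfolding U by simp
  have "card (UNIV :: bit set) = 2" unfolding U by simp
  thus "card (carrier_vec k :: bit vec set) = 2 ^ k"
    using bij_betw_same_card[OF bij] card_lists_length_eq[OF fU, of k] by simp
  show "finite (carrier_vec k :: bit vec set)"
    using bij_betw_finite[OF bij] finite_lists_length_eq[OF fU] by simp
qed

lemma finite_bit_span: "S \<subseteq> carrier_vec k \<Longrightarrow> finite (bit_span k S)"
proof -
  interpret vec_space "TYPE(bit)" k .
  assume "S \<subseteq> carrier_vec k"
  thus ?thesis by (intro finite_subset[OF span_is_subset2 finite_carrier_vec_bit])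
qed

text \<open>Translation by \<open>v\<close> is injective, and the translate is disjoint from the
  span when \<open>v\<close> lies outside it.\<close>

lemma card_bit_span_insert:
  assumes S: "S \<subseteq> carrier_vec k" and v: "v \<in> carrier_vec k" "v \<notin> bit_span k S"
  shows "card (bit_span k (insert v S)) = 2 * card (bit_span k S)"
proof -
  interpret vec_space "TYPE(bit)" k .
  have c: "w \<in> carrier_vec k" if "w \<in> span S" for w
    using span_closed[OF _ that] S by auto
  have inj: "inj_on ((+) v) (span S)"
  proof (rule inj_onI)
    fix x y assume xy: "x \<in> span S" "y \<in> span S" and eq: "v + x = v + y"
    have d: "dim_vec x = k" "dim_vec y = k" using c[OF xy(1)] c[OF xy(2)] by auto
    show "x = y"
    proof (rule eq_vecI)
      fix i assume "i < dim_vec y"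
      thus "x $ i = y $ i" using arg_cong[OF eq, of "\<lambda>z. z $ i"] d by simp
    qed (use d in simp)
  qed
  \<comment> \<open>If both \<open>w\<close> and \<open>v + w\<close> were in the span, then so
    would be \<open>v\<close>.\<close>
  have "v + w \<notin> span S" if w: "w \<in> span S" for w
    using span_add[OF _ w v(1)] v c[OF w] S comm_add_vec[OF v(1) c[OF w]] by auto
  hence "span S \<inter> (+) v ` span S = {}" by auto
  thus ?thesis
    unfolding bit_span_insert[OF S v(1)]
    by (subst card_Un_disjoint) (auto simp: finite_bit_span S card_image[OF inj])
qed

text \<open>Each vector of an independent set lies outside the span of the earlier ones, so the size
  doubles with every vector, starting from the span of the empty set.\<close>

lemma card_bit_span_lin_indpt:
  assumes "finite B" "B \<subseteq> carrier_vec k"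
    and "LinearCombinations.module.lin_indpt class_ring (module_vec TYPE(bit) k) B"
  shows "card (bit_span k B) = 2 ^ card B"
  using assms
proof (induction B rule: finite_induct)
  case empty
  interpret vec_space "TYPE(bit)" k .
  show ?case by (simp add: span_empty)
next
  case (insert v B)
  interpret vec_space "TYPE(bit)" k .
  have ind: "lin_indpt B"
    using insert.prems(2) supset_ld_is_ld[of B "insert v B"] by blast
  have "v \<notin> span B"
    using lin_dep_iff_in_span[OF _ ind _ insert.hyps(2)] insert.prems by auto
  thus ?case using insert ind by (simp add: card_bit_span_insert)
qed

text \<open>A maximal independent set of columns has as many elements as the rank and spans the same
  space as all columns. This turns statements about ranks into counting.\<close>

lemma card_bit_span_cols:
  assumes A: "A \<in> carrier_mat k N"
  shows "card (bit_span k (set (cols A))) = 2 ^ vec_space.rank k (A :: bit mat)"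
proof -
  interpret vec_space "TYPE(bit)" k .
  have C: "set (cols A) \<subseteq> carrier_vec k" using cols_dim A by blast
  obtain B where B: "maximal B (\<lambda>T. T \<subseteq> set (cols A) \<and> lin_indpt T)"
    using maximal_exists_superset[of "set (cols A)" "\<lambda>T. T \<subseteq> set (cols A) \<and> lin_indpt T" "{}"]
    by (auto simp: lin_dep_def)
  hence B': "B \<subseteq> set (cols A)" "lin_indpt B" by (auto simp: maximal_def)
  have Bc: "B \<subseteq> carrier_vec k" using B' C by blast
  have "set (cols A) \<subseteq> span B"
  proof
    fix v assume v: "v \<in> set (cols A)"
    show "v \<in> span B"
    proof (rule ccontr)
      assume nv: "v \<notin> span B"
      hence vB: "v \<notin> B" using span_mem[OF Bc] by blast
      \<comment> \<open>A column outside \<open>span B\<close> could be added to \<open>B\<close>,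
        against maximality.\<close>
      have "lin_indpt (B \<union> {v})"
        using lin_dep_iff_in_span[OF Bc B'(2) _ vB] nv v C by auto
      hence "insert v B = B"
        using B v B' unfolding maximal_def
        by (metis Un_insert_right boolean_algebra.disj_zero_right insert_subset subset_insertI)
      thus False using vB by blast
    qed
  qed
  hence "span (set (cols A)) = span B"
    using span_subsetI[OF Bc] span_is_monotone[OF B'(1)] by blast
  moreover have "finite B" using B' finite_subset by blast
  ultimately show ?thesis
    using card_bit_span_lin_indpt[OF _ Bc B'(2)] rank_card_indpt[OF A B] by simp
qed

section \<open>Rank of the first columns of a sequence of vectors\<close>

text \<open>Columns are indexed by times from 1 on. The same function serves for the generator
  matrix of the scheme, for the discrete model of the columns and for the code.\<close>

definition cols_rank :: "nat \<Rightarrow> nat \<Rightarrow> (nat \<Rightarrow> bit vec) \<Rightarrow> nat" where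
  "cols_rank k N h = vec_space.rank k (mat_of_cols k (map h [1..<Suc N]))"

lemma card_bit_span_cols_rank:
  assumes "\<And>j. j \<in> {1..N} \<Longrightarrow> h j \<in> carrier_vec k"
  shows "card (bit_span k (h ` {1..N})) = 2 ^ cols_rank k N h"
proof -
  have "set (cols (mat_of_cols k (map h [1..<Suc N]))) = h ` {1..N}"
    by (subst cols_mat_of_cols) (use assms in auto)
  moreover have "mat_of_cols k (map h [1..<Suc N]) \<in> carrier_mat k N"
    by (rule carrier_matI) simp_all
  ultimately show ?thesis
    unfolding cols_rank_def using card_bit_span_cols by metis
qed

text \<open>The span keeps its size or doubles; comparing exponents of 2 gives the change of the
  rank.\<close>

lemma cols_rank_Suc:
  assumes "\<And>j. j \<in> {1..Suc N} \<Longrightarrow> h j \<in> carrier_vec k"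
  shows "cols_rank k (Suc N) h =
    (if h (Suc N) \<in> bit_span k (h ` {1..N}) then cols_rank k N h else Suc (cols_rank k N h))"
proof -
  interpret vec_space "TYPE(bit)" k .
  have S: "h ` {1..N} \<subseteq> carrier_vec k" "h (Suc N) \<in> carrier_vec k" using assms by auto
  have ins: "h ` {1..Suc N} = insert (h (Suc N)) (h ` {1..N})"
    by (simp add: atLeastAtMostSuc_conv)
  have "(2::nat) ^ cols_rank k (Suc N) h =
    (if h (Suc N) \<in> span (h ` {1..N}) then 2 ^ cols_rank k N h else 2 ^ Suc (cols_rank k N h))"
    using card_bit_span_cols_rank[of "Suc N" h k] card_bit_span_cols_rank[of N h k]
      card_bit_span_insert[OF S] already_in_span[OF S(1), of "h (Suc N)"] assms
    unfolding ins by auto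
  thus ?thesis by (metis (full_types) one_less_numeral_iff power_inject_exp semiring_norm(76))
qed

lemma cols_rank_le: "cols_rank k N h \<le> N"
  unfolding cols_rank_def by (rule vec_space.rank_le_nc, rule carrier_matI) simp_all

lemma cols_rank_0 [simp]: "cols_rank k 0 h = 0"
  using cols_rank_le[of k 0 h] by simp

lemma cols_rank_eq_imp_span:
  assumes "\<And>j. j \<in> {1..N} \<Longrightarrow> h j \<in> carrier_vec k" and "cols_rank k N h = k"
  shows "bit_span k (h ` {1..N}) = carrier_vec k"
proof (rule card_subset_eq)
  interpret vec_space "TYPE(bit)" k .
  show "span (h ` {1..N}) \<subseteq> carrier_vec k"
    using assms by (intro span_is_subset2) auto
  show "card (span (h ` {1..N})) = card (carrier_vec k :: bit vec set)"
    using card_bit_span_cols_rank[of N h k] assms by simp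
qed simp

text \<open>The difference of two candidates is orthogonal to all columns, hence to their span,
  which is the whole space; testing against unit vectors shows that it is zero. This is why full
  rank permits decoding.\<close>

lemma cols_rank_eq_imp_inj:
  assumes h: "\<And>j. j \<in> {1..N} \<Longrightarrow> h j \<in> carrier_vec k" and r: "cols_rank k N h = k"
    and b: "b \<in> carrier_vec k" "b' \<in> carrier_vec k"
    and eq: "\<And>j. j \<in> {1..N} \<Longrightarrow> scalar_prod (h j) b = scalar_prod (h j) b'"
  shows "b = b'"
proof -
  interpret vec_space "TYPE(bit)" k .
  have H: "h ` {1..N} \<subseteq> carrier_vec k" using h by auto
  have "b - b' \<in> orthogonal_complement (h ` {1..N})"
    unfolding orthogonal_complement_def
    using b h eq by (auto simp: minus_scalar_prod_distrib comm_scalar_prod[of b k] comm_scalar_prod[of b' k])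
  hence "b - b' \<in> orthogonal_complement (carrier_vec k)"
    using in_orthogonal_complement_span[OF H] cols_rank_eq_imp_span[OF h r] by simp
  hence o: "scalar_prod (b - b') (unit_vec k i) = 0" if "i < k" for i
    unfolding orthogonal_complement_def by simp
  show "b = b'"
  proof (rule eq_vecI)
    fix i assume "i < dim_vec b'"
    hence "i < k" using b by simp
    thus "b $ i = b' $ i" using o[of i] b by (cases "b $ i"; cases "b' $ i") auto
  qed (use b in simp)
qed


section \<open>The rank process\<close>

lemma countable_UNIV_bit_vec: "countable (UNIV :: bit vec set)"
proof -
  have "countable (\<Union>k. carrier_vec k :: bit vec set)"
    by (intro countable_UN countableI_type countable_finite finite_carrier_vec_bit)
  moreover have "(UNIV :: bit vec set) \<subseteq> (\<Union>k. carrier_vec k)"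
    using carrier_vecI by blast
  ultimately show ?thesis by (rule countable_subset[rotated])
qed

lemma zero_in_bit_span: "0\<^sub>v k \<in> bit_span k S"
proof -
  interpret vec_space "TYPE(bit)" k .
  have "0\<^sub>v k = lincomb (\<lambda>_. 0) {}" by (simp add: lincomb_def)
  thus ?thesis by (rule in_spanI) auto
qed

text \<open>Serves to read the increment of the rank as a Bernoulli variable.\<close>

lemma map_pmf_eq_bernoulli_pmf:
  "map_pmf P M = bernoulli_pmf (measure_pmf.prob M {x. P x})"
proof (rule pmf_eqI)
  fix b
  have "measure_pmf.prob M {x. \<not> P x} = 1 - measure_pmf.prob M {x. P x}"
    using measure_pmf.prob_compl[of "{x. P x}" M] by (simp add: Compl_eq_Diff_UNIV[symmetric] Collect_neg_eq)
  thus "pmf (map_pmf P M) b = pmf (bernoulli_pmf (measure_pmf.prob M {x. P x})) b"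
    by (cases b) (simp_all add: pmf_map vimage_def)
qed

section \<open>Discrete model of the received columns and their rank\<close>

text \<open>An erasure is encoded as a zero column, which lies in every span and so never raises the
  rank.\<close>

definition rlfc_col :: "real \<Rightarrow> nat \<Rightarrow> nat \<Rightarrow> bit vec pmf" where
  "rlfc_col p k j = map_pmf (\<lambda>(g, e). if e then 0\<^sub>v k else g) (pair_pmf (rlfc_gen k j) (bernoulli_pmf p))"

text \<open>Outside the times 1 to \<open>N\<close> the sequence has the default value
  \<open>0\<^sub>v k\<close>, which \<open>cols_rank k N\<close> does not see.\<close>

definition rlfc_cols :: "real \<Rightarrow> nat \<Rightarrow> nat \<Rightarrow> (nat \<Rightarrow> bit vec) pmf" where
  "rlfc_cols p k N = Pi_pmf {1..N} (0\<^sub>v k) (rlfc_col p k)"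

definition rlfc_rank_pmf :: "real \<Rightarrow> nat \<Rightarrow> nat \<Rightarrow> nat pmf" where
  "rlfc_rank_pmf p k N = map_pmf (cols_rank k N) (rlfc_cols p k N)"

definition rank_step :: "real \<Rightarrow> nat \<Rightarrow> nat pmf" where
  "rank_step q r = map_pmf (\<lambda>b. if b then Suc r else r) (bernoulli_pmf q)"

lemma carrier_vec_minus_zero:
  assumes "k \<ge> 1"
  shows "finite (carrier_vec k - {0\<^sub>v k} :: bit vec set)" "carrier_vec k - {0\<^sub>v k} \<noteq> ({} :: bit vec set)"
    "card (carrier_vec k - {0\<^sub>v k} :: bit vec set) = 2 ^ k - 1"
proof -
  have "0\<^sub>v k \<in> (carrier_vec k :: bit vec set)" by simp
  thus c: "card (carrier_vec k - {0\<^sub>v k} :: bit vec set) = 2 ^ k - 1"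
    by (subst card_Diff_subset) auto
  have "(1::nat) < 2 ^ k" using assms by (intro one_less_power) auto
  thus "carrier_vec k - {0\<^sub>v k} \<noteq> ({} :: bit vec set)" using c by (metis card.empty not_gr_zero zero_less_diff)
qed simp

lemma set_pmf_rlfc_gen:
  assumes "k \<ge> 1"
  shows "set_pmf (rlfc_gen k j) \<subseteq> carrier_vec k"
  using carrier_vec_minus_zero[OF assms] by (auto simp: rlfc_gen_def)

lemma rlfc_cols_carrier:
  assumes "k \<ge> 1" "f \<in> set_pmf (rlfc_cols p k N)" "j \<in> {1..N}"
  shows "f j \<in> carrier_vec k"
proof -
  have "f j \<in> set_pmf (rlfc_col p k j)"
    using assms(2,3) unfolding rlfc_cols_def by (auto simp: set_Pi_pmf PiE_dflt_def)
  thus ?thesis using set_pmf_rlfc_gen[OF assms(1), of j] by (auto simp: rlfc_col_def)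
qed

lemma rlfc_cols_systematic:
  assumes "f \<in> set_pmf (rlfc_cols p k N)" "j \<in> {1..N}" "j \<le> k"
  shows "f j = 0\<^sub>v k \<or> f j = unit_vec k (j - 1)"
proof -
  have "f j \<in> set_pmf (rlfc_col p k j)"
    using assms unfolding rlfc_cols_def by (auto simp: set_Pi_pmf PiE_dflt_def)
  thus ?thesis using assms(3) by (auto simp: rlfc_col_def rlfc_gen_def)
qed

text \<open>As \<open>V\<close> contains the zero vector, a column outside \<open>V\<close> must be
  unerased, and erasures are independent of the generator vectors.\<close>

lemma prob_rlfc_col:
  assumes "0 \<le> p" "p \<le> 1" "0\<^sub>v k \<in> V"
  shows "measure_pmf.prob (rlfc_col p k j) {y. y \<notin> V} = (1 - p) * measure_pmf.prob (rlfc_gen k j) {g. g \<notin> V}"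
proof -
  have "(\<lambda>(g, e). if e then 0\<^sub>v k else g) -` {y. y \<notin> V} = {g. g \<notin> V} \<times> {False}"
    using assms(3) by (auto split: if_splits)
  moreover have "measure_pmf.prob (bernoulli_pmf p) {False} = 1 - p"
    using assms by (simp add: measure_pmf_single)
  moreover have "countable {g::bit vec. g \<notin> V}"
    by (rule countable_subset[OF subset_UNIV countable_UNIV_bit_vec])
  ultimately show ?thesis
    unfolding rlfc_col_def measure_map_pmf by (simp add: measure_pmf_prob_product)
qed

lemma cols_rank_cong: "(\<And>j. j \<in> {1..N} \<Longrightarrow> f j = g j) \<Longrightarrow> cols_rank k N f = cols_rank k N g"
  unfolding cols_rank_def
  by (rule arg_cong[of _ _ "\<lambda>c. vec_space.rank k (mat_of_cols k c)"], rule map_cong) auto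

text \<open>The new column is independent of the earlier ones and raises the rank exactly if it
  leaves their span. The success probability still depends on the span itself; the two phases are
  treated separately below.\<close>

lemma rlfc_rank_pmf_Suc:
  assumes "k \<ge> 1" "0 \<le> p" "p \<le> 1"
  shows "rlfc_rank_pmf p k (Suc N) = bind_pmf (rlfc_cols p k N) (\<lambda>f.
    rank_step ((1 - p) * measure_pmf.prob (rlfc_gen k (Suc N)) {g. g \<notin> bit_span k (f ` {1..N})}) (cols_rank k N f))"
proof -
  interpret vec_space "TYPE(bit)" k .
  have ins: "{1..Suc N} = insert (Suc N) {1..N}" by auto
  have "rlfc_cols p k (Suc N) = map_pmf (\<lambda>(y, f). f(Suc N := y)) (pair_pmf (rlfc_col p k (Suc N)) (rlfc_cols p k N))"
    unfolding rlfc_cols_def ins by (rule Pi_pmf_insert) auto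
  \<comment> \<open>The two independent draws are swapped, so that the earlier columns are fixed
    first.\<close>
  hence "rlfc_cols p k (Suc N) = bind_pmf (rlfc_cols p k N) (\<lambda>f. map_pmf (\<lambda>y. f(Suc N := y)) (rlfc_col p k (Suc N)))"
    unfolding pair_pmf_def map_pmf_def
    by (subst bind_commute_pmf) (simp add: bind_assoc_pmf bind_return_pmf)
  hence "rlfc_rank_pmf p k (Suc N) = bind_pmf (rlfc_cols p k N)
      (\<lambda>f. map_pmf (\<lambda>y. cols_rank k (Suc N) (f(Suc N := y))) (rlfc_col p k (Suc N)))"
    unfolding rlfc_rank_pmf_def by (simp add: map_bind_pmf pmf.map_comp o_def)
  also have "\<dots> = bind_pmf (rlfc_cols p k N) (\<lambda>f.
    rank_step ((1 - p) * measure_pmf.prob (rlfc_gen k (Suc N)) {g. g \<notin> bit_span k (f ` {1..N})}) (cols_rank k N f))"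
  proof (rule bind_pmf_cong[OF refl])
    fix f assume f: "f \<in> set_pmf (rlfc_cols p k N)"
    have c: "f j \<in> carrier_vec k" if "j \<in> {1..N}" for j
      using rlfc_cols_carrier[OF assms(1) f that] .
    let ?V = "span (f ` {1..N})" and ?r = "cols_rank k N f"
    have "map_pmf (\<lambda>y. cols_rank k (Suc N) (f(Suc N := y))) (rlfc_col p k (Suc N)) =
      map_pmf (\<lambda>y. if y \<notin> ?V then Suc ?r else ?r) (rlfc_col p k (Suc N))"
    proof (rule map_pmf_cong[OF refl])
      fix y assume "y \<in> set_pmf (rlfc_col p k (Suc N))"
      hence y: "y \<in> carrier_vec k"
        using set_pmf_rlfc_gen[OF assms(1), of "Suc N"] by (auto simp: rlfc_col_def)
      have im: "(f(Suc N := y)) ` {1..N} = f ` {1..N}" by auto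
      have cr: "cols_rank k N (f(Suc N := y)) = ?r" by (rule cols_rank_cong) auto
      show "cols_rank k (Suc N) (f(Suc N := y)) = (if y \<notin> ?V then Suc ?r else ?r)"
        by (subst cols_rank_Suc) (use y c im cr in auto)
    qed
    also have "\<dots> = map_pmf (\<lambda>b. if b then Suc ?r else ?r) (map_pmf (\<lambda>y. y \<notin> ?V) (rlfc_col p k (Suc N)))"
      by (simp add: pmf.map_comp o_def)
    also have "map_pmf (\<lambda>y. y \<notin> ?V) (rlfc_col p k (Suc N)) =
      bernoulli_pmf ((1 - p) * measure_pmf.prob (rlfc_gen k (Suc N)) {g. g \<notin> ?V})"
      unfolding map_pmf_eq_bernoulli_pmf
      by (subst prob_rlfc_col) (use assms zero_in_bit_span in auto)
    finally show "map_pmf (\<lambda>y. cols_rank k (Suc N) (f(Suc N := y))) (rlfc_col p k (Suc N)) =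
      rank_step ((1 - p) * measure_pmf.prob (rlfc_gen k (Suc N)) {g. g \<notin> ?V}) ?r"
      unfolding rank_step_def .
  qed
  finally show ?thesis .
qed

lemma rlfc_rank_pmf_0: "rlfc_rank_pmf p k 0 = return_pmf 0"
  by (simp add: rlfc_rank_pmf_def rlfc_cols_def)

text \<open>The next unit vector is never in the span of the earlier columns, so only its erasure
  matters.\<close>

lemma rlfc_rank_pmf_Suc_systematic:
  assumes "k \<ge> 1" "0 \<le> p" "p \<le> 1" "N < k"
  shows "rlfc_rank_pmf p k (Suc N) = bind_pmf (rlfc_rank_pmf p k N) (rank_step (1 - p))"
  unfolding rlfc_rank_pmf_Suc[OF assms(1-3)]
  unfolding rlfc_rank_pmf_def bind_map_pmf
proof (rule bind_pmf_cong[OF refl])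
  interpret vec_space "TYPE(bit)" k .
  fix f assume f: "f \<in> set_pmf (rlfc_cols p k N)"
  \<comment> \<open>Coordinates start at 0, so this is the generator vector of time
    \<open>Suc N\<close>. The earlier columns vanish in its coordinate: it is orthogonal to their
    span but not to itself.\<close>
  let ?u = "unit_vec k N :: bit vec"
  have H: "f ` {1..N} \<subseteq> carrier_vec k" using rlfc_cols_carrier[OF assms(1) f] by blast
  have "scalar_prod ?u (f j) = 0" if "j \<in> {1..N}" for j
    using rlfc_cols_systematic[OF f that] that assms(4) by (auto simp: scalar_prod_left_unit)
  hence "?u \<in> orthogonal_complement (f ` {1..N})"
    by (auto simp: orthogonal_complement_def)
  hence "?u \<in> orthogonal_complement (span (f ` {1..N}))"
    using in_orthogonal_complement_span[OF H] by simp
  moreover have "scalar_prod ?u ?u = 1" using assms(4) by (simp add: scalar_prod_left_unit)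
  ultimately have "?u \<notin> span (f ` {1..N})"
    by (auto simp: orthogonal_complement_def)
  hence "measure_pmf.prob (rlfc_gen k (Suc N)) {g. g \<notin> span (f ` {1..N})} = 1"
    using assms(4) by (simp add: rlfc_gen_def)
  thus "rank_step ((1 - p) * measure_pmf.prob (rlfc_gen k (Suc N)) {g. g \<notin> span (f ` {1..N})})
      (cols_rank k N f) = rank_step (1 - p) (cols_rank k N f)"
    by simp
qed

text \<open>Independent increments of probability \<open>1 - p\<close> add up to a binomial
  variable; at \<open>N = k\<close> its values below \<open>k\<close> are the entries of
  \<open>rlfc_alpha\<close>.\<close>

lemma rlfc_rank_pmf_systematic:
  assumes "k \<ge> 1" "0 \<le> p" "p \<le> 1" "N \<le> k"
  shows "rlfc_rank_pmf p k N = binomial_pmf N (1 - p)"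
  using assms(4)
proof (induction N)
  case 0
  show ?case by (simp add: rlfc_rank_pmf_0 binomial_pmf_0 assms)
next
  case (Suc N)
  have "binomial_pmf (Suc N) (1 - p) = bind_pmf (binomial_pmf N (1 - p)) (rank_step (1 - p))"
    unfolding rank_step_def map_pmf_def
    by (subst binomial_pmf_Suc, use assms in simp, subst bind_commute_pmf)
      (intro bind_pmf_cong refl arg_cong[of _ _ return_pmf], auto)
  thus ?case using Suc by (simp add: rlfc_rank_pmf_Suc_systematic assms)
qed

section \<open>The fountain phase as a Markov chain on ranks\<close>

text \<open>The probability that the rank rises from \<open>r\<close> in the fountain phase. It
  vanishes at \<open>r = k\<close>, so full rank is absorbing.\<close>

definition rlfc_theta :: "real \<Rightarrow> nat \<Rightarrow> nat \<Rightarrow> real" where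
  "rlfc_theta p k r = (1 - p) * (2 ^ k - 2 ^ r) / (2 ^ k - 1)"

text \<open>Of the \<open>2 ^ k - 1\<close> vectors that can be drawn, those outside a span of size
  \<open>2 ^ r\<close> number \<open>2 ^ k - 2 ^ r\<close>. The span thus enters only through the
  rank \<open>r\<close>.\<close>

lemma rlfc_rank_pmf_Suc_fountain:
  assumes "k \<ge> 1" "0 \<le> p" "p \<le> 1" "k \<le> N"
  shows "rlfc_rank_pmf p k (Suc N) = bind_pmf (rlfc_rank_pmf p k N) (\<lambda>r. rank_step (rlfc_theta p k r) r)"
  unfolding rlfc_rank_pmf_Suc[OF assms(1-3)]
  unfolding rlfc_rank_pmf_def bind_map_pmf
proof (rule bind_pmf_cong[OF refl])
  interpret vec_space "TYPE(bit)" k .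
  fix f assume f: "f \<in> set_pmf (rlfc_cols p k N)"
  let ?V = "span (f ` {1..N})"
  have H: "f ` {1..N} \<subseteq> carrier_vec k" using rlfc_cols_carrier[OF assms(1) f] by blast
  have V: "?V \<subseteq> carrier_vec k" "finite ?V" "card ?V = 2 ^ cols_rank k N f"
    using span_is_subset2[of "f ` {1..N}"] H finite_bit_span[OF H]
      card_bit_span_cols_rank[of N f k] rlfc_cols_carrier[OF assms(1) f] by auto
  \<comment> \<open>The vector excluded from the draw lies in the span, so no vector outside the
    span is lost.\<close>
  have "(carrier_vec k - {0\<^sub>v k}) \<inter> {g. g \<notin> ?V} = carrier_vec k - ?V"
    using zero_in_bit_span by auto
  hence "measure_pmf.prob (rlfc_gen k (Suc N)) {g. g \<notin> ?V} = real (card (carrier_vec k - ?V)) / real (2 ^ k - 1)"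
    using assms(4) carrier_vec_minus_zero[OF assms(1)]
    by (simp add: rlfc_gen_def measure_pmf_of_set del: of_nat_diff)
  also have "card (carrier_vec k - ?V) = 2 ^ k - 2 ^ cols_rank k N f"
    using V by (simp add: card_Diff_subset)
  also have "real (2 ^ k - 2 ^ cols_rank k N f) / real (2 ^ k - 1) = (2 ^ k - 2 ^ cols_rank k N f) / (2 ^ k - 1)"
    using V card_mono[OF finite_carrier_vec_bit V(1)] by (simp add: of_nat_diff)
  finally show "rank_step ((1 - p) * measure_pmf.prob (rlfc_gen k (Suc N)) {g. g \<notin> ?V}) (cols_rank k N f) =
      rank_step (rlfc_theta p k (cols_rank k N f)) (cols_rank k N f)"
    by (simp add: rlfc_theta_def)
qed

lemma set_rlfc_rank_pmf:
  assumes "k \<ge> 1"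
  shows "set_pmf (rlfc_rank_pmf p k N) \<subseteq> {..k} \<inter> {..N}"
proof -
  interpret vec_space "TYPE(bit)" k .
  have "cols_rank k N f \<le> k" if f: "f \<in> set_pmf (rlfc_cols p k N)" for f
  proof -
    have H: "f ` {1..N} \<subseteq> carrier_vec k" using rlfc_cols_carrier[OF assms f] by blast
    have "(2::nat) ^ cols_rank k N f \<le> 2 ^ k"
      using card_bit_span_cols_rank[of N f k] rlfc_cols_carrier[OF assms f]
        card_mono[OF finite_carrier_vec_bit span_is_subset2[OF H]] by simp
    thus ?thesis by simp
  qed
  thus ?thesis using cols_rank_le by (auto simp: rlfc_rank_pmf_def)
qed

lemma pmf_rank_step:
  assumes "0 \<le> q" "q \<le> 1"
  shows "pmf (rank_step q r) i = (if i = Suc r then q else if i = r then 1 - q else 0)"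
proof -
  have "(\<lambda>b. if b then Suc r else r) -` {i} = (if i = Suc r then {True} else if i = r then {False} else {})"
    by (auto split: if_splits)
  thus ?thesis using assms by (simp add: rank_step_def pmf_map measure_pmf_single)
qed

lemma rlfc_theta_bounds:
  assumes "k \<ge> 1" "0 \<le> p" "p \<le> 1" "r \<le> k"
  shows "0 \<le> rlfc_theta p k r" "rlfc_theta p k r \<le> 1"
proof -
  have k: "(1::real) < 2 ^ k" using assms by simp
  have r: "(1::real) \<le> 2 ^ r" "(2::real) ^ r \<le> 2 ^ k" using assms by auto
  show "0 \<le> rlfc_theta p k r" using assms k r by (simp add: rlfc_theta_def)
  have "(1 - p) * (2 ^ k - 2 ^ r) \<le> 1 * (2 ^ k - 1)"
    using assms r by (intro mult_mono) auto
  thus "rlfc_theta p k r \<le> 1" using k by (simp add: rlfc_theta_def)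
qed

text \<open>One step multiplies the row vector of the probabilities of the ranks below
  \<open>k\<close> by \<open>rlfc_T\<close>.\<close>

lemma pmf_rlfc_rank_Suc:
  assumes "k \<ge> 1" "0 \<le> p" "p \<le> 1" "k \<le> N" "j < k"
  shows "pmf (rlfc_rank_pmf p k (Suc N)) j = (\<Sum>i<k. pmf (rlfc_rank_pmf p k N) i * rlfc_T p k $$ (i, j))"
proof -
  have k: "(1::real) < 2 ^ k" using assms by simp
  have "pmf (rlfc_rank_pmf p k (Suc N)) j = (\<Sum>r\<le>k. pmf (rank_step (rlfc_theta p k r) r) j * pmf (rlfc_rank_pmf p k N) r)"
    unfolding rlfc_rank_pmf_Suc_fountain[OF assms(1-4)] pmf_bind
    using set_rlfc_rank_pmf[OF assms(1), of p N] by (intro integral_measure_pmf_real) auto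
  \<comment> \<open>The term \<open>r = k\<close> drops out, because a step never lowers the
    rank.\<close>
  also have "\<dots> = (\<Sum>r\<in>{..<k}. pmf (rank_step (rlfc_theta p k r) r) j * pmf (rlfc_rank_pmf p k N) r)"
    using assms pmf_rank_step[OF rlfc_theta_bounds[OF assms(1-3), of k]]
    by (intro sum.mono_neutral_right) (auto simp: not_less)
  also have "\<dots> = (\<Sum>i<k. pmf (rlfc_rank_pmf p k N) i * rlfc_T p k $$ (i, j))"
  proof (rule sum.cong[OF refl])
    fix r assume r: "r \<in> {..<k}"
    have "1 - rlfc_theta p k r = p + (1 - p) * (2 ^ r - 1) / (2 ^ k - 1)"
      using k by (simp add: rlfc_theta_def field_simps)
    hence "pmf (rank_step (rlfc_theta p k r) r) j = rlfc_T p k $$ (r, j)"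
      using r assms pmf_rank_step[OF rlfc_theta_bounds[OF assms(1-3), of r]]
      by (simp add: rlfc_T_def rlfc_theta_def)
    thus "pmf (rank_step (rlfc_theta p k r) r) j * pmf (rlfc_rank_pmf p k N) r =
        pmf (rlfc_rank_pmf p k N) r * rlfc_T p k $$ (r, j)" by simp
  qed
  finally show ?thesis .
qed

text \<open>The vector \<open>w\<close> is arbitrary so that the induction can move one factor of
  the matrix power onto it.\<close>

lemma rlfc_rank_pmf_matrix:
  assumes "k \<ge> 1" "0 \<le> p" "p \<le> 1" "w \<in> carrier_vec k"
  shows "scalar_prod (rlfc_alpha p k) ((rlfc_T p k ^\<^sub>m d) *\<^sub>v w) = (\<Sum>i<k. pmf (rlfc_rank_pmf p k (k + d)) i * w $ i)"
  using assms(4)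
proof (induction d arbitrary: w)
  case 0
  have "pmf (rlfc_rank_pmf p k k) i = real (k choose i) * (1 - p) ^ i * p ^ (k - i)" if "i < k" for i
    using assms that by (simp add: rlfc_rank_pmf_systematic)
  moreover have "dim_row (rlfc_T p k) = k" by (simp add: rlfc_T_def)
  ultimately show ?case using 0
    by (simp add: scalar_prod_def rlfc_alpha_def atLeast0LessThan)
next
  case (Suc d)
  let ?T = "rlfc_T p k" and ?q = "\<lambda>N i. pmf (rlfc_rank_pmf p k N) i"
  have T: "?T \<in> carrier_mat k k" by (simp add: rlfc_T_def)
  have "scalar_prod (rlfc_alpha p k) ((?T ^\<^sub>m Suc d) *\<^sub>v w) = scalar_prod (rlfc_alpha p k) ((?T ^\<^sub>m d) *\<^sub>v (?T *\<^sub>v w))"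
    using T Suc.prems by (simp add: assoc_mult_mat_vec[of _ k k _ k])
  also have "\<dots> = (\<Sum>i<k. ?q (k + d) i * (?T *\<^sub>v w) $ i)"
    by (rule Suc.IH) (use T Suc.prems in auto)
  also have "\<dots> = (\<Sum>i<k. \<Sum>j<k. ?q (k + d) i * (?T $$ (i, j) * w $ j))"
  proof (rule sum.cong[OF refl])
    fix i assume "i \<in> {..<k}"
    hence "(?T *\<^sub>v w) $ i = (\<Sum>j<k. ?T $$ (i, j) * w $ j)"
      using T Suc.prems by (simp add: scalar_prod_def atLeast0LessThan)
    thus "?q (k + d) i * (?T *\<^sub>v w) $ i = (\<Sum>j<k. ?q (k + d) i * (?T $$ (i, j) * w $ j))"
      by (simp add: sum_distrib_left)
  qed
  also have "\<dots> = (\<Sum>j<k. \<Sum>i<k. ?q (k + d) i * (?T $$ (i, j) * w $ j))"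
    by (rule sum.swap)
  also have "\<dots> = (\<Sum>j<k. ?q (Suc (k + d)) j * w $ j)"
    by (rule sum.cong[OF refl]) (simp add: pmf_rlfc_rank_Suc assms sum_distrib_right mult.assoc)
  finally show ?case by simp
qed

text \<open>Fewer than \<open>k\<close> columns cannot have rank \<open>k\<close>; afterwards full
  rank is the complement of the ranks below \<open>k\<close>, whose mass is obtained with the
  all-ones vector as \<open>w\<close>.\<close>

lemma pmf_rlfc_rank_full:
  assumes "k \<ge> 1" "0 \<le> p" "p \<le> 1"
  shows "pmf (rlfc_rank_pmf p k N) k =
    (if N < k then 0 else 1 - scalar_prod (rlfc_alpha p k) ((rlfc_T p k ^\<^sub>m (N - k)) *\<^sub>v vec k (\<lambda>_. 1)))"
proof (cases "N < k")
  case True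
  hence "k \<notin> set_pmf (rlfc_rank_pmf p k N)" using set_rlfc_rank_pmf[OF assms(1)] by fastforce
  thus ?thesis using True by (simp add: set_pmf_iff)
next
  case False
  have "(\<Sum>i\<in>{..k}. pmf (rlfc_rank_pmf p k N) i) = 1"
    using set_rlfc_rank_pmf[OF assms(1), of p N] by (intro sum_pmf_eq_1) auto
  hence "pmf (rlfc_rank_pmf p k N) k = 1 - (\<Sum>i<k. pmf (rlfc_rank_pmf p k N) i)"
    by (simp add: lessThan_Suc_atMost[symmetric])
  thus ?thesis using False
      rlfc_rank_pmf_matrix[OF assms, of "vec k (\<lambda>_. 1)" "N - k"] by simp
qed


section \<open>Finite marginals of infinite product spaces\<close>

text \<open>Point masses agree factor by factor, and splitting a sequence of pairs into a pair of
  sequences is injective.\<close>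

lemma pair_Pi_pmf:
  assumes "finite A"
  shows "pair_pmf (Pi_pmf A d P) (Pi_pmf A d' Q) =
    map_pmf (\<lambda>h. (fst \<circ> h, snd \<circ> h)) (Pi_pmf A (d, d') (\<lambda>j. pair_pmf (P j) (Q j)))"
proof (rule pmf_eqI, clarify)
  fix g :: "'a \<Rightarrow> 'b" and e :: "'a \<Rightarrow> 'c"
  let ?f = "\<lambda>h :: 'a \<Rightarrow> 'b \<times> 'c. (fst \<circ> h, snd \<circ> h)"
  have inj: "inj ?f"
    by (rule injI) (auto simp: fun_eq_iff prod_eq_iff)
  have ge: "(g, e) = ?f (\<lambda>j. (g j, e j))" by (simp add: o_def)
  have "pmf (map_pmf ?f (Pi_pmf A (d, d') (\<lambda>j. pair_pmf (P j) (Q j)))) (g, e) =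
    pmf (Pi_pmf A (d, d') (\<lambda>j. pair_pmf (P j) (Q j))) (\<lambda>j. (g j, e j))"
    unfolding ge by (rule pmf_map_inj'[OF inj])
  also have "\<dots> = pmf (pair_pmf (Pi_pmf A d P) (Pi_pmf A d' Q)) (g, e)"
    using assms by (auto simp: pmf_Pi pmf_pair prod.distrib)
  finally show "pmf (pair_pmf (Pi_pmf A d P) (Pi_pmf A d' Q)) (g, e) =
    pmf (map_pmf ?f (Pi_pmf A (d, d') (\<lambda>j. pair_pmf (P j) (Q j)))) (g, e)" by simp
qed

text \<open>Separates generator vectors from erasures, as the two product spaces supply
  them.\<close>

lemma rlfc_cols_eq_map_pmf:
  "rlfc_cols p k N = map_pmf (\<lambda>(g, e) j. if e j then 0\<^sub>v k else g j)
    (pair_pmf (Pi_pmf {1..N} (0\<^sub>v k) (rlfc_gen k)) (Pi_pmf {1..N} False (\<lambda>_. bernoulli_pmf p)))"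
proof -
  have "rlfc_cols p k N = map_pmf (\<lambda>h. (\<lambda>(g, e). if e then 0\<^sub>v k else g) \<circ> h)
      (Pi_pmf {1..N} (0\<^sub>v k, False) (\<lambda>j. pair_pmf (rlfc_gen k j) (bernoulli_pmf p)))"
    unfolding rlfc_cols_def rlfc_col_def by (rule Pi_pmf_map) auto
  also have "\<dots> = map_pmf (\<lambda>(g, e) j. if e j then 0\<^sub>v k else g j)
    (pair_pmf (Pi_pmf {1..N} (0\<^sub>v k) (rlfc_gen k)) (Pi_pmf {1..N} False (\<lambda>_. bernoulli_pmf p)))"
    unfolding pair_Pi_pmf[OF finite_atLeastAtMost] pmf.map_comp
    by (rule map_pmf_cong[OF refl]) (auto simp: fun_eq_iff split: prod.splits)
  finally show ?thesis .
qed

text \<open>Allows one horizon, the last decoding time, to serve for all earlier times.\<close>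

lemma rlfc_rank_pmf_eq_map_pmf:
  assumes "t \<le> N"
  shows "rlfc_rank_pmf p k t = map_pmf (cols_rank k t) (rlfc_cols p k N)"
proof -
  have "rlfc_cols p k t = map_pmf (\<lambda>f x. if x \<in> {1..t} then f x else 0\<^sub>v k) (rlfc_cols p k N)"
    unfolding rlfc_cols_def using assms by (intro Pi_pmf_subset) auto
  thus ?thesis
    unfolding rlfc_rank_pmf_def
    by (simp add: pmf.map_comp o_def) (intro map_pmf_cong refl cols_rank_cong, auto)
qed

text \<open>Countability makes the finite product \<sigma>-algebra discrete, so every event about
  the coordinates in \<open>J\<close> is measurable. The value \<open>d\<close> outside
  \<open>J\<close> matches the default of \<open>Pi_pmf\<close>.\<close>

lemma
  fixes P :: "'i \<Rightarrow> 'a pmf"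
  assumes cnt: "countable (UNIV :: 'a set)" and J: "finite J" "J \<subseteq> I"
  shows measurable_PiM_measure_pmf:
      "(\<lambda>x i. if i \<in> J then x i else d) \<in> (\<Pi>\<^sub>M i\<in>I. measure_pmf (P i)) \<rightarrow>\<^sub>M count_space UNIV" (is ?meas)
    and distr_PiM_measure_pmf:
      "distr (\<Pi>\<^sub>M i\<in>I. measure_pmf (P i)) (count_space UNIV) (\<lambda>x i. if i \<in> J then x i else d) =
        measure_pmf (Pi_pmf J d P)" (is ?distr)
proof -
  interpret product_prob_space "\<lambda>i. measure_pmf (P i)" I
    by (intro product_prob_spaceI measure_pmf.prob_space_axioms)
  define G :: "('i \<Rightarrow> 'a) \<Rightarrow> 'i \<Rightarrow> 'a" where "G = (\<lambda>h i. if i \<in> J then h i else d)"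
  let ?M = "\<Pi>\<^sub>M i\<in>J. measure_pmf (P i)" and ?r = "\<lambda>x :: 'i \<Rightarrow> 'a. restrict x J"
  have "sets ?M = sets (\<Pi>\<^sub>M i\<in>J. count_space (UNIV :: 'a set))"
    by (rule sets_PiM_cong) auto
  also have "\<dots> = Pow (PiE J (\<lambda>_. UNIV))"
    using count_space_PiM_finite[OF J(1), of "\<lambda>_. UNIV :: 'a set"] cnt by simp
  finally have setsM: "sets ?M = Pow (space ?M)" by (simp add: space_PiM)
  have G: "G \<in> ?M \<rightarrow>\<^sub>M count_space UNIV"
    by (rule measurableI) (auto simp: setsM)
  have r: "?r \<in> (\<Pi>\<^sub>M i\<in>I. measure_pmf (P i)) \<rightarrow>\<^sub>M ?M"
    using J(2) by (rule measurable_restrict_subset)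
  have Gr: "(\<lambda>x i. if i \<in> J then x i else d) = G \<circ> ?r"
    by (auto simp: G_def fun_eq_iff)
  show ?meas unfolding Gr by (rule measurable_comp[OF r G])
  have r': "?r \<in> measure_pmf (Pi_pmf J d P) \<rightarrow>\<^sub>M ?M"
    by (auto simp: space_PiM)
  \<comment> \<open>A product measure is determined by its values on boxes.\<close>
  have M: "distr (measure_pmf (Pi_pmf J d P)) ?M ?r = ?M"
  proof (rule PiM_eqI)
    fix A assume A: "\<And>i. i \<in> J \<Longrightarrow> A i \<in> sets (measure_pmf (P i))"
    have pre: "?r -` Pi\<^sub>E J A = Pi J A" by (auto simp: PiE_iff Pi_iff)
    have "emeasure (distr (measure_pmf (Pi_pmf J d P)) ?M ?r) (Pi\<^sub>E J A) =
      emeasure (measure_pmf (Pi_pmf J d P)) (Pi J A)"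
      by (subst emeasure_distr[OF r']) (auto intro!: sets_PiM_I_finite J simp: pre)
    also have "\<dots> = ennreal (\<Prod>i\<in>J. measure_pmf.prob (P i) (A i))"
      by (simp add: measure_pmf.emeasure_eq_measure measure_Pi_pmf_Pi J)
    also have "\<dots> = (\<Prod>i\<in>J. emeasure (measure_pmf (P i)) (A i))"
      by (simp add: measure_pmf.emeasure_eq_measure prod_ennreal)
    finally show "emeasure (distr (measure_pmf (Pi_pmf J d P)) ?M ?r) (Pi\<^sub>E J A) =
      (\<Prod>i\<in>J. emeasure (measure_pmf (P i)) (A i))" .
  qed (use J in auto)
  have "distr (\<Pi>\<^sub>M i\<in>I. measure_pmf (P i)) (count_space UNIV) (G \<circ> ?r) = distr ?M (count_space UNIV) G"
    unfolding distr_distr[OF G r, symmetric] distr_PiM_restrict_finite[OF J] ..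
  also have "\<dots> = distr (measure_pmf (Pi_pmf J d P)) (count_space UNIV) (G \<circ> ?r)"
    by (subst (1) M[symmetric]) (rule distr_distr[OF G r'])
  also have "\<dots> = measure_pmf (map_pmf (G \<circ> ?r) (Pi_pmf J d P))"
    by (simp add: map_pmf_rep_eq)
  \<comment> \<open>On the support the coordinates outside \<open>J\<close> already equal
    \<open>d\<close>.\<close>
  also have "map_pmf (G \<circ> ?r) (Pi_pmf J d P) = map_pmf (\<lambda>x. x) (Pi_pmf J d P)"
    by (rule map_pmf_cong[OF refl]) (auto simp: G_def fun_eq_iff set_Pi_pmf J PiE_dflt_def)
  finally show ?distr unfolding Gr by (simp only: map_pmf_ident)
qed

section \<open>Pairs of independent discrete variables\<close>

lemma measure_pair_measure_Times:
  assumes "sigma_finite_measure N" "X \<in> sets M" "Y \<in> sets N"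
  shows "measure (M \<Otimes>\<^sub>M N) (X \<times> Y) = measure M X * measure N Y"
  using assms by (simp add: measure_def sigma_finite_measure.emeasure_pair_measure_Times enn2real_mult)

lemma (in prob_space) distr_pair_snd_comp:
  assumes "sigma_finite_measure N" and f: "f \<in> N \<rightarrow>\<^sub>M L"
  shows "distr (M \<Otimes>\<^sub>M N) L (\<lambda>z. f (snd z)) = distr N L f"
proof (rule measure_eqI)
  interpret N: sigma_finite_measure N by fact
  fix A assume "A \<in> sets (distr (M \<Otimes>\<^sub>M N) L (\<lambda>z. f (snd z)))"
  hence A: "A \<in> sets L" by simp
  have "(\<lambda>z. f (snd z)) -` A \<inter> space (M \<Otimes>\<^sub>M N) = space M \<times> (f -` A \<inter> space N)"
    by (auto simp: space_pair_measure)
  thus "emeasure (distr (M \<Otimes>\<^sub>M N) L (\<lambda>z. f (snd z))) A = emeasure (distr N L f) A"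
    using A f by (simp add: emeasure_distr N.emeasure_pair_measure_Times emeasure_space_1 measurable_sets)
qed simp

lemma prob_pair_pmf_Times_singleton:
  "measure_pmf.prob (pair_pmf \<alpha> \<beta>) (X \<times> {y}) = measure_pmf.prob \<alpha> X * pmf \<beta> y"
proof -
  \<comment> \<open>Cutting \<open>X\<close> down to the support makes it countable, as the product
    rule requires.\<close>
  have "measure_pmf.prob (pair_pmf \<alpha> \<beta>) (X \<times> {y}) =
    measure_pmf.prob (pair_pmf \<alpha> \<beta>) ((X \<inter> set_pmf \<alpha>) \<times> {y})"
    by (subst (1 2) measure_Int_set_pmf[symmetric]) (rule arg_cong[of _ _ "measure_pmf.prob _"], auto)
  also have "\<dots> = measure_pmf.prob \<alpha> (X \<inter> set_pmf \<alpha>) * measure_pmf.prob \<beta> {y}"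
    by (intro measure_pmf_prob_product countable_Int2 countable_set_pmf) auto
  finally show ?thesis by (simp add: measure_Int_set_pmf measure_pmf_single)
qed

text \<open>The second component has to take finitely many values, since a product of discrete
  \<open>\<sigma>\<close>-algebras on uncountable types is not discrete.\<close>

lemma
  assumes A: "prob_space A" and B: "prob_space B"
    and a: "a \<in> A \<rightarrow>\<^sub>M count_space UNIV" "distr A (count_space UNIV) a = measure_pmf \<alpha>"
    and b: "b \<in> B \<rightarrow>\<^sub>M count_space UNIV" "distr B (count_space UNIV) b = measure_pmf \<beta>"
    and S: "finite S" "b ` space B \<subseteq> S"
  shows sets_pair_discrete:
      "{z \<in> space (A \<Otimes>\<^sub>M B). Q (a (fst z)) (b (snd z))} \<in> sets (A \<Otimes>\<^sub>M B)" (is "?E \<in> _")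
    and prob_pair_discrete:
      "\<P>(z in A \<Otimes>\<^sub>M B. Q (a (fst z)) (b (snd z))) = measure_pmf.prob (pair_pmf \<alpha> \<beta>) {(x, y). Q x y}"
proof -
  interpret A: prob_space A by fact
  interpret B: prob_space B by fact
  interpret AB: pair_prob_space A B ..
  define X where "X y = {x \<in> space A. Q (a x) y}" for y
  define Y where "Y y = {x \<in> space B. b x = y}" for y
  have X: "X y \<in> sets A" for y
    using measurable_sets[OF a(1), of "{x. Q x y}"] by (simp add: X_def vimage_def Int_def conj_commute)
  have Y: "Y y \<in> sets B" for y
    using measurable_sets[OF b(1), of "{y}"] by (simp add: Y_def vimage_def Int_def conj_commute)
  have pX: "measure A (X y) = measure_pmf.prob \<alpha> {x. Q x y}" for y
    unfolding a(2)[symmetric] by (subst measure_distr[OF a(1)]) (auto simp: X_def intro!: arg_cong[of _ _ "measure A"])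
  have pY: "measure B (Y y) = pmf \<beta> y" for y
    unfolding measure_pmf_single[symmetric] b(2)[symmetric]
    by (subst measure_distr[OF b(1)]) (auto simp: Y_def intro!: arg_cong[of _ _ "measure B"])
  \<comment> \<open>Splitting by the finitely many values of \<open>b\<close> gives disjoint
    measurable rectangles.\<close>
  have E: "?E = (\<Union>y\<in>S. X y \<times> Y y)"
    using S(2) by (auto simp: X_def Y_def space_pair_measure)
  show "?E \<in> sets (A \<Otimes>\<^sub>M B)"
    unfolding E using X Y S(1) by (intro sets.finite_UN) auto
  have "measure (A \<Otimes>\<^sub>M B) ?E = (\<Sum>y\<in>S. measure (A \<Otimes>\<^sub>M B) (X y \<times> Y y))"
    unfolding E using X Y S(1)
    by (intro AB.finite_measure_finite_Union) (auto simp: disjoint_family_on_def Y_def)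
  also have "\<dots> = (\<Sum>y\<in>S. measure_pmf.prob \<alpha> {x. Q x y} * pmf \<beta> y)"
    using X Y by (simp add: measure_pair_measure_Times[OF B.sigma_finite_measure_axioms] pX pY)
  also have "\<dots> = (\<Sum>y\<in>S. measure_pmf.prob (pair_pmf \<alpha> \<beta>) ({x. Q x y} \<times> {y}))"
    by (simp add: prob_pair_pmf_Times_singleton)
  also have "\<dots> = measure_pmf.prob (pair_pmf \<alpha> \<beta>) (\<Union>y\<in>S. {x. Q x y} \<times> {y})"
    using S(1) by (intro measure_pmf.finite_measure_finite_Union[symmetric]) (auto simp: disjoint_family_on_def)
  \<comment> \<open>Pairs whose second entry is outside \<open>S\<close> have mass zero.\<close>
  also have "\<dots> = measure_pmf.prob (pair_pmf \<alpha> \<beta>) {(x, y). Q x y}"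
  proof (rule measure_prob_cong_0)
    have "set_pmf \<beta> \<subseteq> S"
    proof
      fix y assume "y \<in> set_pmf \<beta>"
      hence "measure B (Y y) \<noteq> 0" unfolding pY by (simp add: set_pmf_iff)
      hence "Y y \<noteq> {}" by auto
      thus "y \<in> S" using S(2) by (auto simp: Y_def)
    qed
    thus "pmf (pair_pmf \<alpha> \<beta>) z = 0" if "z \<in> {(x, y). Q x y} - (\<Union>y\<in>S. {x. Q x y} \<times> {y})" for z
      using that by (auto simp: pmf_pair pmf_eq_0_set_pmf)
  qed auto
  finally show "\<P>(z in A \<Otimes>\<^sub>M B. Q (a (fst z)) (b (snd z))) = measure_pmf.prob (pair_pmf \<alpha> \<beta>) {(x, y). Q x y}" .
qed

lemma prob_space_bec_erasures: "prob_space (bec_erasures p)"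
  unfolding bec_erasures_def by (intro prob_space_PiM measure_pmf.prob_space_axioms)

lemma finite_bool_fun: "finite ((\<lambda>x i. if i \<in> {1..N} then x i else False) ` X :: (nat \<Rightarrow> bool) set)"
proof (rule finite_subset)
  show "(\<lambda>x i. if i \<in> {1..N} then x i else False) ` X \<subseteq> PiE_dflt {1..N} False (\<lambda>_. UNIV)"
    by (auto simp: PiE_dflt_def)
qed (intro finite_PiE_dflt, auto)

lemma nth_map_upt_1: "j < t \<Longrightarrow> map f [1..<Suc t] ! j = f (Suc j)"
  by (simp del: upt_Suc)

text \<open>Carries the discrete results over to the sample space of the scheme. The matrix depends
  on the generator vectors and erasures up to time \<open>t\<close> but not on the message, whose
  factor has total mass 1.\<close>

lemma prob_rlfc_rank:
  "\<P>(\<omega> in rlfc_space p k. rlfc_rank k t \<omega> = r) = pmf (rlfc_rank_pmf p k t) r"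
proof -
  let ?PG = "\<Pi>\<^sub>M n\<in>{1..}. measure_pmf (rlfc_gen k n)"
  let ?B = "measure_pmf (pmf_of_set (carrier_vec k)) :: bit vec measure"
  let ?a = "\<lambda>x i. if i \<in> {1..t} then x i else 0\<^sub>v k" and ?b = "\<lambda>x i. if i \<in> {1..t} then x i else False"
  let ?Q = "\<lambda>g e. cols_rank k t (\<lambda>j. if e j then 0\<^sub>v k else g j) = r"
  interpret PG: prob_space ?PG by (intro prob_space_PiM measure_pmf.prob_space_axioms)
  interpret E: prob_space "bec_erasures p" by (rule prob_space_bec_erasures)
  interpret GE: pair_prob_space ?PG "bec_erasures p" ..
  have a: "?a \<in> ?PG \<rightarrow>\<^sub>M count_space UNIV"
      "distr ?PG (count_space UNIV) ?a = measure_pmf (Pi_pmf {1..t} (0\<^sub>v k) (rlfc_gen k))"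
    by (intro measurable_PiM_measure_pmf distr_PiM_measure_pmf countable_UNIV_bit_vec; auto)+
  have b: "?b \<in> bec_erasures p \<rightarrow>\<^sub>M count_space UNIV"
      "distr (bec_erasures p) (count_space UNIV) ?b = measure_pmf (Pi_pmf {1..t} False (\<lambda>_. bernoulli_pmf p))"
    unfolding bec_erasures_def
    by (intro measurable_PiM_measure_pmf distr_PiM_measure_pmf; auto)+
  have rank: "rlfc_rank k t \<omega> = cols_rank k t (\<lambda>j. if ?b (snd (snd \<omega>)) j then 0\<^sub>v k else ?a (fst (snd \<omega>)) j)" for \<omega>
  proof -
    have "rlfc_matrix k t \<omega> = mat_of_cols k (map (\<lambda>j. if ?b (snd (snd \<omega>)) j then 0\<^sub>v k else ?a (fst (snd \<omega>)) j) [1..<Suc t])"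
      unfolding rlfc_matrix_def mat_of_cols_def
      by (rule cong_mat) (auto simp: rlfc_received_def bec_output_def nth_map_upt_1 simp del: upt_Suc split: prod.splits)
    thus ?thesis by (simp add: rlfc_rank_def cols_rank_def)
  qed
  let ?ev = "{z \<in> space (?PG \<Otimes>\<^sub>M bec_erasures p). ?Q (?a (fst z)) (?b (snd z))}"
  have ev: "?ev \<in> sets (?PG \<Otimes>\<^sub>M bec_erasures p)"
    using sets_pair_discrete[OF PG.prob_space_axioms E.prob_space_axioms a b finite_bool_fun subset_refl] .
  have "{\<omega> \<in> space (rlfc_space p k). rlfc_rank k t \<omega> = r} = space ?B \<times> ?ev"
    unfolding rank by (auto simp: rlfc_space_def space_pair_measure cong: if_cong)
  hence "\<P>(\<omega> in rlfc_space p k. rlfc_rank k t \<omega> = r) = measure ?B (space ?B) * measure (?PG \<Otimes>\<^sub>M bec_erasures p) ?ev"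
    unfolding rlfc_space_def using measure_pair_measure_Times[OF GE.P.sigma_finite_measure_axioms _ ev, of "space ?B" ?B] by simp
  also have "\<dots> = measure (?PG \<Otimes>\<^sub>M bec_erasures p) ?ev"
    by (simp add: measure_pmf.prob_space)
  also have "\<dots> = measure_pmf.prob (pair_pmf (Pi_pmf {1..t} (0\<^sub>v k) (rlfc_gen k))
      (Pi_pmf {1..t} False (\<lambda>_. bernoulli_pmf p))) {(g, e). ?Q g e}"
    by (rule prob_pair_discrete[OF PG.prob_space_axioms E.prob_space_axioms a b finite_bool_fun subset_refl])
  also have "\<dots> = pmf (rlfc_rank_pmf p k t) r"
    unfolding rlfc_rank_pmf_def rlfc_cols_eq_map_pmf pmf_map measure_map_pmf
    by (rule arg_cong[of _ _ "measure_pmf.prob _"]) auto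
  finally show ?thesis .
qed


section \<open>The stop-feedback code\<close>

text \<open>The finitely many outcomes are numbered, which gives common randomness on a finite
  alphabet of natural numbers.\<close>

lemma ex_nat_coded_pmf:
  assumes "finite (set_pmf \<Gamma>)"
  obtains R :: "nat measure" and G where "finite (space R)" "sets R = Pow (space R)" "prob_space R"
    "distr R (count_space UNIV) G = measure_pmf \<Gamma>" "G ` space R \<subseteq> set_pmf \<Gamma>"
proof -
  let ?S = "set_pmf \<Gamma>"
  obtain x0 where x0: "x0 \<in> ?S" using set_pmf_not_empty by fast
  \<comment> \<open>Points outside the support, of mass zero, are sent to the number of
    \<open>x0\<close> so that \<open>c\<close> maps into the alphabet.\<close>
  define c where "c x = to_nat_on ?S (if x \<in> ?S then x else x0)" for x
  define R where "R = distr (measure_pmf \<Gamma>) (count_space (to_nat_on ?S ` ?S)) c"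
  let ?G = "from_nat_into ?S"
  have c: "c \<in> measure_pmf \<Gamma> \<rightarrow>\<^sub>M count_space (to_nat_on ?S ` ?S)"
    using x0 by (auto simp: c_def)
  have G: "?G \<in> count_space (to_nat_on ?S ` ?S) \<rightarrow>\<^sub>M count_space UNIV" by simp
  have "distr R (count_space UNIV) ?G = measure_pmf (map_pmf (?G \<circ> c) \<Gamma>)"
    unfolding R_def distr_distr[OF G c] by (simp only: map_pmf_rep_eq)
  also have "map_pmf (?G \<circ> c) \<Gamma> = map_pmf (\<lambda>x. x) \<Gamma>"
    by (rule map_pmf_cong[OF refl]) (simp add: c_def)
  finally have "distr R (count_space UNIV) ?G = measure_pmf \<Gamma>" by (simp only: map_pmf_ident)
  moreover have "prob_space R"
    unfolding R_def by (rule measure_pmf.prob_space_distr[OF c])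
  moreover have "finite (space R)" "sets R = Pow (space R)" "?G ` space R \<subseteq> ?S"
    using assms by (auto simp: R_def)
  ultimately show thesis by (intro that)
qed

section \<open>Construction of the code and its full-rank events\<close>

text \<open>\<open>G\<close> recovers the generator sequence from the common randomness and
  \<open>\<beta>\<close> turns message numbers into bit vectors. The law of the sequence is that of
  the scheme up to time \<open>n m\<close>.\<close>

locale st_rlfc_code =
  fixes p :: real and k m :: nat and n :: "nat \<Rightarrow> nat"
    and R :: "'u measure" and G :: "'u \<Rightarrow> nat \<Rightarrow> bit vec" and \<beta> :: "nat \<Rightarrow> bit vec"
  assumes p: "0 \<le> p" "p \<le> 1" and k: "k \<ge> 1" and m: "m \<ge> 1"
    and n: "strict_mono_on {1..m} n"
    and R: "finite (space R)" "sets R = Pow (space R)" "prob_space R"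
    and distr_G: "distr R (count_space UNIV) G = measure_pmf (Pi_pmf {1..n m} (0\<^sub>v k) (rlfc_gen k))"
    and G_carrier: "u \<in> space R \<Longrightarrow> G u j \<in> carrier_vec k"
    and \<beta>: "bij_betw \<beta> {1..2 ^ k} (carrier_vec k)"
begin

definition good :: "nat \<Rightarrow> 'u \<times> nat \<times> (nat \<Rightarrow> bool) \<Rightarrow> bool" where
  "good t = (\<lambda>(u, w, e). cols_rank k t (\<lambda>j. if e j then 0\<^sub>v k else G u j) = k)"

definition consistent :: "nat \<Rightarrow> 'u \<Rightarrow> bit option list \<Rightarrow> nat \<Rightarrow> bool" where
  "consistent t u y w \<longleftrightarrow> w \<in> {1..2 ^ k} \<and> (\<forall>j<t. y ! j \<in> {None, Some (scalar_prod (G u (Suc j)) (\<beta> w))})"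

text \<open>Inserting \<open>n m\<close> forces a stop at the last decoding time even without full
  rank. The decoder falls back on message 1 when no message fits the received word.\<close>

definition code :: "'u vlsf_code" where
  "code = \<lparr>rand = R, enc = (\<lambda>j u w. scalar_prod (G u j) (\<beta> w)),
    stop = (\<lambda>\<omega>. Min (insert (n m) (n ` {i \<in> {1..m}. good (n i) \<omega>}))),
    dec = (\<lambda>t u y. if \<exists>w. consistent t u y w then SOME w. consistent t u y w else 1)\<rparr>"

abbreviation \<Omega> where "\<Omega> \<equiv> vlsf_space p (2 ^ k) code"

lemma n_le: "i \<in> {1..m} \<Longrightarrow> j \<in> {1..m} \<Longrightarrow> n i \<le> n j \<longleftrightarrow> i \<le> j"
  using strict_mono_on_less_eq[OF n] by blast

lemma space_\<Omega>: "(u, w, e) \<in> space \<Omega> \<longleftrightarrow> u \<in> space R \<and> w \<in> {1..2 ^ k} \<and> e \<in> space (bec_erasures p)"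
  by (simp add: vlsf_space_def code_def space_pair_measure space_uniform_count_measure)

lemma received_nth:
  "j < t \<Longrightarrow> vlsf_received code t (u, w, e) ! j =
    (if e (Suc j) then None else Some (scalar_prod (G u (Suc j)) (\<beta> w)))"
  by (simp add: vlsf_received_def nth_map_upt_1 bec_output_def code_def del: upt_Suc)

lemma good_cong:
  assumes "\<And>j. j \<in> {1..t} \<Longrightarrow> e j = e' j"
  shows "good t (u, w, e) \<longleftrightarrow> good t (u, w', e')"
proof -
  have "cols_rank k t (\<lambda>j. if e j then 0\<^sub>v k else G u j) = cols_rank k t (\<lambda>j. if e' j then 0\<^sub>v k else G u j)"
    by (rule cols_rank_cong) (simp add: assms)
  thus ?thesis by (simp add: good_def)
qed

text \<open>Erasures are visible in the received word, so full rank can be recognised without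
  knowing the message.\<close>

lemma good_received:
  assumes "vlsf_received code t (u, w, e) = vlsf_received code t (u, w', e')"
  shows "good t (u, w, e) \<longleftrightarrow> good t (u, w', e')"
proof (rule good_cong)
  fix j assume "j \<in> {1..t}"
  then obtain i where "j = Suc i" "i < t" by (cases j) auto
  thus "e j = e' j"
    using received_nth[of i t u w e] received_nth[of i t u w' e'] assms by (auto split: if_splits)
qed

text \<open>The message does not affect \<open>good\<close>, so only the generator sequence and the
  erasures up to \<open>n m\<close> enter, and both have the laws of the discrete model.\<close>

lemma
  shows prob_space_\<Omega>: "prob_space \<Omega>"
    and sets_good: "t \<le> n m \<Longrightarrow> {\<omega> \<in> space \<Omega>. good t \<omega>} \<in> sets \<Omega>"
    and prob_good: "t \<le> n m \<Longrightarrow> \<P>(\<omega> in \<Omega>. good t \<omega>) = pmf (rlfc_rank_pmf p k t) k"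
proof -
  let ?U = "uniform_count_measure {1..2 ^ k :: nat}" and ?E = "bec_erasures p"
  interpret R: prob_space R by (rule R)
  interpret U: prob_space ?U by (rule prob_space_uniform_count_measure) auto
  interpret E: prob_space ?E by (rule prob_space_bec_erasures)
  interpret UE: pair_prob_space ?U ?E ..
  interpret RUE: pair_prob_space R "?U \<Otimes>\<^sub>M ?E" ..
  have \<Omega>: "\<Omega> = R \<Otimes>\<^sub>M (?U \<Otimes>\<^sub>M ?E)" by (simp add: vlsf_space_def code_def)
  show "prob_space \<Omega>" unfolding \<Omega> by (rule RUE.P.prob_space_axioms)
  \<comment> \<open>Truncated erasure patterns take finitely many values, as the lemma on pairs
    demands.\<close>
  let ?tr = "\<lambda>x i. if i \<in> {1..n m} then x i else False"
  let ?b = "\<lambda>z. ?tr (snd z)"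
  let ?Q = "\<lambda>g e. cols_rank k t (\<lambda>j. if e j then 0\<^sub>v k else g j) = k"
  have G: "G \<in> R \<rightarrow>\<^sub>M count_space UNIV" using R by (auto simp: measurable_def)
  have tr: "?tr \<in> ?E \<rightarrow>\<^sub>M count_space UNIV"
      "distr ?E (count_space UNIV) ?tr = measure_pmf (Pi_pmf {1..n m} False (\<lambda>_. bernoulli_pmf p))"
    unfolding bec_erasures_def
    by (intro measurable_PiM_measure_pmf distr_PiM_measure_pmf; auto)+
  have b: "?b \<in> ?U \<Otimes>\<^sub>M ?E \<rightarrow>\<^sub>M count_space UNIV"
    using tr(1) by (rule measurable_compose[OF measurable_snd])
  have db: "distr (?U \<Otimes>\<^sub>M ?E) (count_space UNIV) ?b =
      measure_pmf (Pi_pmf {1..n m} False (\<lambda>_. bernoulli_pmf p))"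
    using U.distr_pair_snd_comp[OF E.sigma_finite_measure_axioms tr(1)] tr(2) by simp
  have S: "?b ` space (?U \<Otimes>\<^sub>M ?E) \<subseteq> ?tr ` UNIV" by auto
  note disc = R.prob_space_axioms UE.P.prob_space_axioms G distr_G b db finite_bool_fun S
  assume t: "t \<le> n m"
  have good: "good t \<omega> \<longleftrightarrow> ?Q (G (fst \<omega>)) (?b (snd \<omega>))" for \<omega>
  proof -
    obtain u w e where \<omega>: "\<omega> = (u, w, e)" by (cases \<omega>)
    have "good t (u, w, e) \<longleftrightarrow> good t (u, w, ?tr e)" using t by (intro good_cong) auto
    thus ?thesis by (simp only: \<omega> good_def prod.case fst_conv snd_conv)
  qed
  show "{\<omega> \<in> space \<Omega>. good t \<omega>} \<in> sets \<Omega>"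
    unfolding good \<Omega> using disc by (rule sets_pair_discrete)
  have "\<P>(\<omega> in \<Omega>. good t \<omega>) = measure_pmf.prob (pair_pmf (Pi_pmf {1..n m} (0\<^sub>v k) (rlfc_gen k))
      (Pi_pmf {1..n m} False (\<lambda>_. bernoulli_pmf p))) {(g, e). ?Q g e}"
    unfolding good \<Omega> using disc by (rule prob_pair_discrete)
  also have "\<dots> = pmf (rlfc_rank_pmf p k t) k"
    unfolding rlfc_rank_pmf_eq_map_pmf[OF t] rlfc_cols_eq_map_pmf pmf_map measure_map_pmf
    by (rule arg_cong[of _ _ "measure_pmf.prob _"]) auto
  finally show "\<P>(\<omega> in \<Omega>. good t \<omega>) = pmf (rlfc_rank_pmf p k t) k" .
qed

section \<open>The stopping rule and the filtration\<close>

lemma stop_code: "stop code \<omega> = Min (insert (n m) (n ` {i \<in> {1..m}. good (n i) \<omega>}))"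
  by (simp add: code_def)

lemma stop_in: "stop code \<omega> \<in> n ` {1..m}"
proof -
  have "stop code \<omega> \<in> insert (n m) (n ` {i \<in> {1..m}. good (n i) \<omega>})"
    unfolding stop_code by (rule Min_in) auto
  thus ?thesis using m by auto
qed

lemma stop_le_iff: "stop code \<omega> \<le> t \<longleftrightarrow> n m \<le> t \<or> (\<exists>i\<in>{1..m}. good (n i) \<omega> \<and> n i \<le> t)"
  unfolding stop_code by (subst Min_le_iff) auto

text \<open>Here \<open>n m\<close> itself has full rank, so every candidate for the minimum
  does.\<close>

lemma stop_good:
  assumes "good (n m) \<omega>"
  obtains j where "j \<in> {1..m}" "stop code \<omega> = n j" "good (n j) \<omega>"
proof -
  have "stop code \<omega> \<in> insert (n m) (n ` {i \<in> {1..m}. good (n i) \<omega>})"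
    unfolding stop_code by (rule Min_in) auto
  thus thesis using assms m that by auto
qed

text \<open>Samples with equal randomness and equal received words at the decoding times up to
  \<open>t\<close> agree on \<open>good\<close> there, hence on whether the code has stopped by
  \<open>t\<close>.\<close>

lemma stopping_time_code: "stopping_time (vlsf_filtration p n m (2 ^ k) code) (stop code)"
  unfolding stopping_time_def
proof
  fix t
  let ?f = "\<lambda>\<omega>. (fst \<omega>, \<lambda>i\<in>{i \<in> {1..m}. n i \<le> t}. vlsf_received code (n i) \<omega>)"
  have "stop code \<omega>' \<le> t" if f: "?f \<omega> = ?f \<omega>'" and le: "stop code \<omega> \<le> t" for \<omega> \<omega>'
  proof -
    obtain u w e w' e' where \<omega>: "\<omega> = (u, w, e)" "\<omega>' = (u, w', e')"
      using f by (cases \<omega>; cases \<omega>') auto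
    have "good (n i) \<omega> \<longleftrightarrow> good (n i) \<omega>'" if "i \<in> {1..m}" "n i \<le> t" for i
      unfolding \<omega>
    proof (rule good_received)
      have "snd (?f \<omega>) i = snd (?f \<omega>') i" using f by simp
      thus "vlsf_received code (n i) (u, w, e) = vlsf_received code (n i) (u, w', e')"
        using that by (simp add: \<omega>)
    qed
    thus ?thesis using le unfolding stop_le_iff by blast
  qed
  note key = this
  let ?S = "{\<omega> \<in> space \<Omega>. stop code \<omega> \<le> t}"
  \<comment> \<open>The event is a union of fibres of the generating map, hence the preimage of its
    own image.\<close>
  have eq: "?S = ?f -` ?f ` ?S \<inter> space \<Omega>"
  proof (rule subset_antisym; rule subsetI)
    fix \<omega> assume "\<omega> \<in> ?S"
    thus "\<omega> \<in> ?f -` ?f ` ?S \<inter> space \<Omega>" by (intro IntI vimageI2 imageI) simp_all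
  next
    fix \<omega>' assume \<omega>': "\<omega>' \<in> ?f -` ?f ` ?S \<inter> space \<Omega>"
    from \<omega>' have "?f \<omega>' \<in> ?f ` ?S" by (rule vimageD[OF IntD1])
    then obtain \<omega> where f: "?f \<omega>' = ?f \<omega>" and S: "\<omega> \<in> ?S" by (rule imageE)
    have "stop code \<omega>' \<le> t" using S by (intro key[OF f[symmetric]]) simp
    thus "\<omega>' \<in> ?S" using IntD2[OF \<omega>'] by (intro CollectI conjI)
  qed
  have "?S \<in> sets (vlsf_filtration p n m (2 ^ k) code t)"
    unfolding vlsf_filtration_def by (subst eq, rule in_vimage_algebra) simp
  thus "Measurable.pred (vlsf_filtration p n m (2 ^ k) code t) (\<lambda>\<omega>. stop code \<omega> \<le> t)"
    by (simp add: pred_def vlsf_filtration_def)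
qed

section \<open>Decoding and error probability\<close>

lemma dec_in: "dec code t u y \<in> {1..2 ^ k}"
proof (cases "\<exists>w. consistent t u y w")
  case True
  hence "consistent t u y (SOME w. consistent t u y w)" by (rule someI_ex)
  hence "(SOME w. consistent t u y w) \<in> {1..2 ^ k}" unfolding consistent_def by (rule conjunct1)
  thus ?thesis using True by (simp add: code_def)
next
  case False
  hence "dec code t u y = 1" unfolding code_def by (simp only: vlsf_code.simps if_False)
  thus ?thesis by simp
qed

text \<open>The code then stops at full rank, where the sent message is consistent and injectivity
  excludes all others.\<close>

lemma decision_correct:
  assumes \<omega>: "(u, w, e) \<in> space \<Omega>" and g: "good (n m) (u, w, e)"
  shows "vlsf_decision code (u, w, e) = w"
proof -
  obtain j where j: "stop code (u, w, e) = n j" "good (n j) (u, w, e)"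
    using stop_good[OF g] by metis
  let ?y = "vlsf_received code (n j) (u, w, e)" and ?h = "\<lambda>j. if e j then 0\<^sub>v k else G u j"
  have u: "u \<in> space R" and w: "w \<in> {1..2 ^ k}" using \<omega> by (auto simp: space_\<Omega>)
  have bc: "\<beta> v \<in> carrier_vec k" if "v \<in> {1..2 ^ k}" for v using bij_betwE[OF \<beta>] that by blast
  have cw: "consistent (n j) u ?y w" using w by (simp add: consistent_def received_nth)
  have "v = w" if cv: "consistent (n j) u ?y v" for v
  proof -
    have v: "v \<in> {1..2 ^ k}" using cv by (simp add: consistent_def)
    have "\<beta> v = \<beta> w"
    proof (rule cols_rank_eq_imp_inj[of "n j" ?h k])
      show "cols_rank k (n j) ?h = k" using j(2) by (simp add: good_def)
      show "?h i \<in> carrier_vec k" for i using G_carrier[OF u] by simp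
      fix i assume "i \<in> {1..n j}"
      then obtain i' where i: "i = Suc i'" "i' < n j" by (cases i) auto
      \<comment> \<open>At an unerased time this forces equal inner products; at an erased time the
        column is zero and both products vanish.\<close>
      have "?y ! i' \<in> {None, Some (scalar_prod (G u (Suc i')) (\<beta> v))}"
        using cv i(2) unfolding consistent_def by blast
      thus "scalar_prod (?h i) (\<beta> v) = scalar_prod (?h i) (\<beta> w)"
        using bc[OF v] bc[OF w] by (auto simp: received_nth i)
    qed (use bc v w in auto)
    thus "v = w" using bij_betw_imp_inj_on[OF \<beta>] v w by (auto dest: inj_onD)
  qed
  hence "(SOME v. consistent (n j) u ?y v) = w" using cw by (metis someI)
  thus ?thesis using cw by (auto simp: vlsf_decision_def j(1)) (simp add: code_def; blast)
qed

lemma error_prob: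
  "\<P>(\<omega> in \<Omega>. vlsf_decision code \<omega> \<noteq> fst (snd \<omega>)) \<le> 1 - pmf (rlfc_rank_pmf p k (n m)) k"
proof -
  interpret prob_space \<Omega> by (rule prob_space_\<Omega>)
  \<comment> \<open>Monotonicity of the measure asks for measurability of the larger event
    only.\<close>
  have sub: "{\<omega> \<in> space \<Omega>. vlsf_decision code \<omega> \<noteq> fst (snd \<omega>)} \<subseteq> space \<Omega> - {\<omega> \<in> space \<Omega>. good (n m) \<omega>}"
    using decision_correct by auto
  have "prob {\<omega> \<in> space \<Omega>. vlsf_decision code \<omega> \<noteq> fst (snd \<omega>)} \<le> prob (space \<Omega> - {\<omega> \<in> space \<Omega>. good (n m) \<omega>})"
    using sub sets_good[of "n m"] by (intro finite_measure_mono) auto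
  also have "\<dots> = 1 - pmf (rlfc_rank_pmf p k (n m)) k"
    using prob_compl[OF sets_good[of "n m"]] prob_good[of "n m"] by simp
  finally show ?thesis .
qed

section \<open>Expected decoding time\<close>

text \<open>If the code stops at \<open>n j\<close>, then full rank at \<open>n i\<close> implies
  \<open>j \<le> i\<close>. The gaps from \<open>j\<close> on telescope to
  \<open>n m - n j\<close>.\<close>

lemma stop_bound:
  "real (stop code \<omega>) \<le> real (n m) -
    (\<Sum>i\<in>{1..<m}. (real (n (i + 1)) - real (n i)) * of_bool (good (n i) \<omega>))"
proof -
  obtain j where j: "j \<in> {1..m}" "stop code \<omega> = n j" using stop_in by blast
  have "(\<Sum>i\<in>{1..<m}. (real (n (i + 1)) - real (n i)) * of_bool (good (n i) \<omega>)) \<le>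
    (\<Sum>i\<in>{1..<m}. (real (n (i + 1)) - real (n i)) * of_bool (j \<le> i))"
  proof (rule sum_mono)
    fix i assume i: "i \<in> {1..<m}"
    have "j \<le> i" if "good (n i) \<omega>"
    proof -
      have "stop code \<omega> \<le> n i" unfolding stop_le_iff using that i by auto
      thus ?thesis using n_le[of j i] j i by simp
    qed
    moreover have "n i \<le> n (i + 1)" using n_le[of i "i + 1"] i by simp
    ultimately show "(real (n (i + 1)) - real (n i)) * of_bool (good (n i) \<omega>) \<le>
        (real (n (i + 1)) - real (n i)) * of_bool (j \<le> i)"
      by (intro mult_left_mono) (auto simp: of_bool_def)
  qed
  also have "\<dots> = (\<Sum>i\<in>{j..<m}. real (n (Suc i)) - real (n i))"
    using j(1) by (intro sum.mono_neutral_cong_right) auto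
  also have "\<dots> = real (n m) - real (n j)" using j(1) by (intro sum_Suc_diff') auto
  finally show ?thesis by (simp add: j(2))
qed

lemma expected_stop:
  "(\<integral>\<omega>. real (stop code \<omega>) \<partial>\<Omega>) \<le> real (n m) -
    (\<Sum>i\<in>{1..<m}. (real (n (i + 1)) - real (n i)) * pmf (rlfc_rank_pmf p k (n i)) k)"
proof -
  interpret prob_space \<Omega> by (rule prob_space_\<Omega>)
  let ?A = "\<lambda>i. {\<omega> \<in> space \<Omega>. good (n i) \<omega>}" and ?d = "\<lambda>i. real (n (i + 1)) - real (n i)"
  let ?g = "\<lambda>\<omega>. real (n m) - (\<Sum>i\<in>{1..<m}. ?d i * indicator (?A i) \<omega>)"
  have le: "n i \<le> n m" if "i \<in> {1..<m}" for i using n_le[of i m] that by simp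
  have int: "integrable \<Omega> (\<lambda>\<omega>. ?d i * indicator (?A i) \<omega>)" if "i \<in> {1..<m}" for i
    using sets_good[OF le[OF that]] by (intro integrable_mult_right integrable_real_indicator) (auto simp: emeasure_eq_measure)
  have bound: "real (stop code \<omega>) \<le> ?g \<omega>" if "\<omega> \<in> space \<Omega>" for \<omega>
    using stop_bound[of \<omega>] that by (simp add: indicator_def of_bool_def cong: if_cong)
  have "(\<integral>\<omega>. real (stop code \<omega>) \<partial>\<Omega>) \<le> (\<integral>\<omega>. ?g \<omega> \<partial>\<Omega>)"
  \<comment> \<open>Only the upper bound has to be integrable; it is nonnegative since it dominates
    a stopping time.\<close>
  proof (rule integral_mono')
    show "integrable \<Omega> ?g" using int by (intro Bochner_Integration.integrable_diff Bochner_Integration.integrable_sum) auto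
    show "0 \<le> ?g \<omega>" if "\<omega> \<in> space \<Omega>" for \<omega> using bound[OF that] by linarith
  qed (rule bound)
  also have "(\<integral>\<omega>. ?g \<omega> \<partial>\<Omega>) =
      (\<integral>\<omega>. real (n m) \<partial>\<Omega>) - (\<integral>\<omega>. (\<Sum>i\<in>{1..<m}. ?d i * indicator (?A i) \<omega>) \<partial>\<Omega>)"
    by (intro Bochner_Integration.integral_diff Bochner_Integration.integrable_sum int) auto
  also have "(\<integral>\<omega>. real (n m) \<partial>\<Omega>) = real (n m)" by (simp add: prob_space)
  also have "(\<integral>\<omega>. (\<Sum>i\<in>{1..<m}. ?d i * indicator (?A i) \<omega>) \<partial>\<Omega>) =
      (\<Sum>i\<in>{1..<m}. \<integral>\<omega>. ?d i * indicator (?A i) \<omega> \<partial>\<Omega>)"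
    by (intro Bochner_Integration.integral_sum int)
  also have "(\<Sum>i\<in>{1..<m}. \<integral>\<omega>. ?d i * indicator (?A i) \<omega> \<partial>\<Omega>) =
      (\<Sum>i\<in>{1..<m}. ?d i * pmf (rlfc_rank_pmf p k (n i)) k)"
  proof (rule sum.cong[OF refl])
    fix i assume i: "i \<in> {1..<m}"
    have "?A i \<inter> space \<Omega> = ?A i" by auto
    thus "(\<integral>\<omega>. ?d i * indicator (?A i) \<omega> \<partial>\<Omega>) = ?d i * pmf (rlfc_rank_pmf p k (n i)) k"
      using prob_good[OF le[OF i]] by simp
  qed
  finally show ?thesis .
qed

lemma is_vlsf_code_code:
  "is_vlsf_code p (real (n m) - (\<Sum>i\<in>{1..<m}. (real (n (i + 1)) - real (n i)) * pmf (rlfc_rank_pmf p k (n i)) k))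
    n m (2 ^ k) (1 - pmf (rlfc_rank_pmf p k (n m)) k) code"
proof -
  have "rand code = R" by (simp add: code_def)
  thus ?thesis
    unfolding is_vlsf_code_def
    using R stop_in stopping_time_code expected_stop dec_in error_prob by simp
qed

end

theorem theorem4:
  fixes p :: real and m k :: nat and n :: "nat \<Rightarrow> nat"
  assumes "0 \<le> p" "p < 1"
    and "m \<ge> 1" "k \<ge> 1"
    and "\<forall>i\<in>{1..m}. n i \<ge> 1"
    and "strict_mono_on {1..m} n"
  shows "(\<exists>l \<epsilon>. \<exists>c :: nat vlsf_code.
            is_vlsf_code p l n m (2 ^ k) \<epsilon> c \<and>
            l \<le> real (n m) - (\<Sum>i\<in>{1..<m}. (real (n (i + 1)) - real (n i)) *
                                 \<P>(\<omega> in rlfc_space p k. rlfc_rank k (n i) \<omega> = k)) \<and>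
            \<epsilon> \<le> 1 - \<P>(\<omega> in rlfc_space p k. rlfc_rank k (n m) \<omega> = k)) \<and>
         (\<forall>N\<ge>1. \<P>(\<omega> in rlfc_space p k. rlfc_rank k N \<omega> = k) =
            (if N < k then 0
             else 1 - scalar_prod (rlfc_alpha p k)
                        ((rlfc_T p k ^\<^sub>m (N - k)) *\<^sub>v vec k (\<lambda>_. 1))))"
proof (intro conjI allI impI)
  \<comment> \<open>Cutting the generator sequence at \<open>n m\<close> leaves a finite support,
    hence a finite alphabet.\<close>
  let ?\<Gamma> = "Pi_pmf {1..n m} (0\<^sub>v k) (rlfc_gen k)"
  have gen: "set_pmf (rlfc_gen k j) \<subseteq> carrier_vec k" for j
    using assms by (intro set_pmf_rlfc_gen) simp
  have "finite (set_pmf ?\<Gamma>)"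
    by (auto simp: set_Pi_pmf intro!: finite_PiE_dflt finite_subset[OF gen])
  then obtain R :: "nat measure" and G where R: "finite (space R)" "sets R = Pow (space R)" "prob_space R"
    "distr R (count_space UNIV) G = measure_pmf ?\<Gamma>" "G ` space R \<subseteq> set_pmf ?\<Gamma>"
    by (rule ex_nat_coded_pmf)
  have G: "G u j \<in> carrier_vec k" if "u \<in> space R" for u j
  proof -
    have "G u \<in> set_pmf ?\<Gamma>" using imageI[OF that, of G] by (rule subsetD[OF R(5)])
    hence "G u \<in> PiE_dflt {1..n m} (0\<^sub>v k) (set_pmf \<circ> rlfc_gen k)"
      unfolding set_Pi_pmf[OF finite_atLeastAtMost] .
    \<comment> \<open>After time \<open>n m\<close> the value is the default zero vector, which has
      dimension \<open>k\<close> too.\<close>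
    thus ?thesis using gen[of j] by (cases "j \<in> {1..n m}") (auto simp: PiE_dflt_def)
  qed
  \<comment> \<open>Any numbering of the messages will do.\<close>
  have "\<exists>\<beta>. bij_betw \<beta> {1..2 ^ k :: nat} (carrier_vec k :: bit vec set)"
    by (rule finite_same_card_bij) simp_all
  then obtain \<beta> where \<beta>: "bij_betw \<beta> {1..2 ^ k :: nat} (carrier_vec k :: bit vec set)" ..
  interpret st_rlfc_code p k m n R G \<beta>
  proof (rule st_rlfc_code.intro)
    show "p \<le> 1" using assms(2) by simp
  qed (fact assms R \<beta> | erule G)+
  show "\<exists>l \<epsilon>. \<exists>c :: nat vlsf_code.
      is_vlsf_code p l n m (2 ^ k) \<epsilon> c \<and>
      l \<le> real (n m) - (\<Sum>i\<in>{1..<m}. (real (n (i + 1)) - real (n i)) *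
                           \<P>(\<omega> in rlfc_space p k. rlfc_rank k (n i) \<omega> = k)) \<and>
      \<epsilon> \<le> 1 - \<P>(\<omega> in rlfc_space p k. rlfc_rank k (n m) \<omega> = k)"
    unfolding prob_rlfc_rank using is_vlsf_code_code by blast
next
  fix N
  show "\<P>(\<omega> in rlfc_space p k. rlfc_rank k N \<omega> = k) =
      (if N < k then 0
       else 1 - scalar_prod (rlfc_alpha p k) ((rlfc_T p k ^\<^sub>m (N - k)) *\<^sub>v vec k (\<lambda>_. 1)))"
    unfolding prob_rlfc_rank using assms by (intro pmf_rlfc_rank_full) auto
qed

end
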